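(* Consider predictive density estimation of the density of $Y_1$ under $\alpha$-divergence loss $L_\alpha$, based on $X=x=(x_1,x_2)$. (a) Let $-1\le\alpha<1$ and let $\hat q_{\pi_{U,A}}$ be the Bayes predictive density with respect to the (uniform) prior $\pi_{U,A}(\theta)=\mathbb{I}_A(\theta_1-\theta_2)$. Then, as a function of $y_1\in\mathbb{R}^p$, $$\hat q_{\pi_{U,A}}(y_1;x)\ \propto\ \hat q_{\mathrm{mre}}(y_1;x_1)\; I^{\frac{2}{1-\alpha}}(y_1;x),$$ where $\hat q_{\mathrm{mre}}(\cdot;x_1)$, the minimum risk equivariant predictive density based on $x_1$, is the $N_p\big(x_1,(\sigma_1^2\frac{1-\alpha}{2}+\sigma_Y^2)I_p\big)$ density, and $I(y_1;x)=\mathbb{P}(T\in A)$ with $T\sim N_p(\mu_T,\sigma_T^2I_p)$, $\mu_T=\beta(y_1-x_1)+(x_1-x_2)$, $\sigma_T^2=\frac{2\sigma_1^2\sigma_Y^2}{(1-\alpha)\sigma_1^2+2\sigma_Y^2}+\sigma_2^2$, and $\beta=\frac{(1-\alpha)\sigma_1^2}{(1-\alpha)\sigma_1^2+2\sigma_Y^2}$. (b) Let $\alpha=1$ (reverse Kullback-Leibler loss) and let $\hat q_\pi$ be the Bayes predictive density with respect to a prior $\pi$ for $\theta$. Then $\hat q_\pi(\cdot;x)$ is the $N_p(\mathbb{E}(\theta_1\mid x),\sigma_Y^2I_p)$ density, where $\mathbb{E}(\theta_1\mid x)$ is the posterior expectation of $\theta_1$.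
   Context: Model: $X=(X_1,X_2)$ and $Y_1$, with $X_1\sim N_p(\theta_1,\sigma_1^2I_p)$, $X_2\sim N_p(\theta_2,\sigma_2^2I_p)$, $Y_1\sim N_p(\theta_1,\sigma_Y^2I_p)$ independent, where $\sigma_1^2,\sigma_2^2,\sigma_Y^2>0$ are known, $\theta=(\theta_1,\theta_2)\in\mathbb{R}^{2p}$, $\theta_1-\theta_2\in A\subset\mathbb{R}^p$. Let $q_{\theta_1}$ be the density of $Y_1$. $\alpha$-divergence loss: $L_\alpha(\theta,\hat q)=\int_{\mathbb{R}^p}h_\alpha\!\left(\frac{\hat q(y;x)}{q_{\theta_1}(y)}\right)q_{\theta_1}(y)\,dy$, where $h_\alpha(z)=\frac{4}{1-\alpha^2}(1-z^{(1+\alpha)/2})$ for $|\alpha|<1$, $h_1(z)=z\log z$, $h_{-1}(z)=-\log z$. The Bayes predictive density for a (possibly improper) prior is the density $\hat q(\cdot;x)$ minimizing the posterior expected loss given $X=x$; posterior distributions (and posterior expectations, in (b)) are assumed to exist (for $\pi_{U,A}$ this means $A$ is measurable with positive Lebesgue measure). *)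

theory Defs
  imports "HOL-Probability.Probability"
begin

text \<open>Density of the isotropic normal law with mean \<open>\<mu>\<close> and covariance \<open>v\<close> times the identity; the
  second argument is a variance, not a standard deviation.\<close>

definition mvn_density :: "real ^ 'p \<Rightarrow> real \<Rightarrow> real ^ 'p \<Rightarrow> real" where
  "mvn_density \<mu> v y =
     (2 * pi * v) powr (- real CARD('p) / 2) * exp (- (norm (y - \<mu>))\<^sup>2 / (2 * v))"

text \<open>Integral with values in the extended reals (positive part minus negative part).  Losses and
  risks may be \<open>\<infinity>\<close>, for which the Bochner integral would return \<open>0\<close>.\<close>

definition ereal_integral :: "'a measure \<Rightarrow> ('a \<Rightarrow> ereal) \<Rightarrow> ereal" where
  "ereal_integral M f =
     enn2ereal (\<integral>\<^sup>+ x. e2ennreal (f x) \<partial>M) - enn2ereal (\<integral>\<^sup>+ x. e2ennreal (- f x) \<partial>M)"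

text \<open>Only \<open>- 1 \<le> \<alpha> \<le> 1\<close> and \<open>z \<ge> 0\<close> matter.  At \<open>z = 0\<close> the value is \<open>\<infinity>\<close> for \<open>\<alpha> = - 1\<close> (set
  explicitly, because \<open>ln 0 = 0\<close> in HOL) and \<open>0\<close> for \<open>\<alpha> = 1\<close>.\<close>

definition h_alpha :: "real \<Rightarrow> real \<Rightarrow> ereal" where
  "h_alpha \<alpha> z =
     (if \<alpha> = 1 then ereal (z * ln z)
      else if \<alpha> = - 1 then (if z = 0 then \<infinity> else ereal (- ln z))
      else ereal (4 / (1 - \<alpha>\<^sup>2) * (1 - z powr ((1 + \<alpha>) / 2))))"

definition prob_density :: "(real ^ 'p \<Rightarrow> real) \<Rightarrow> bool" where
  "prob_density q \<longleftrightarrow>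
     q \<in> borel_measurable borel \<and> (\<forall>y. 0 \<le> q y) \<and> (\<integral>\<^sup>+ y. ennreal (q y) \<partial>lborel) = 1"

text \<open>The loss depends on \<open>\<theta> = (\<theta>1, \<theta>2)\<close> through \<open>\<theta>1\<close> only.\<close>

definition alpha_loss :: "real \<Rightarrow> real \<Rightarrow> real ^ 'p \<Rightarrow> (real ^ 'p \<Rightarrow> real) \<Rightarrow> ereal" where
  "alpha_loss \<alpha> \<sigma>Y \<theta>1 q =
     ereal_integral lborel
       (\<lambda>y. h_alpha \<alpha> (q y / mvn_density \<theta>1 (\<sigma>Y\<^sup>2) y) * ereal (mvn_density \<theta>1 (\<sigma>Y\<^sup>2) y))"

definition likelihood ::
  "real \<Rightarrow> real \<Rightarrow> (real ^ 'p) \<times> (real ^ 'p) \<Rightarrow> (real ^ 'p) \<times> (real ^ 'p) \<Rightarrow> real" where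
  "likelihood \<sigma>1 \<sigma>2 x \<theta> =
     mvn_density (fst \<theta>) (\<sigma>1\<^sup>2) (fst x) * mvn_density (snd \<theta>) (\<sigma>2\<^sup>2) (snd x)"

text \<open>A prior is an arbitrary, possibly infinite measure on the pairs \<open>(\<theta>1, \<theta>2)\<close>.\<close>

definition marginal ::
  "real \<Rightarrow> real \<Rightarrow> ((real ^ 'p) \<times> (real ^ 'p)) measure \<Rightarrow> (real ^ 'p) \<times> (real ^ 'p) \<Rightarrow> ennreal" where
  "marginal \<sigma>1 \<sigma>2 \<pi> x = (\<integral>\<^sup>+ \<theta>. ennreal (likelihood \<sigma>1 \<sigma>2 x \<theta>) \<partial>\<pi>)"

definition posterior_exists ::
  "real \<Rightarrow> real \<Rightarrow> ((real ^ 'p) \<times> (real ^ 'p)) measure \<Rightarrow> (real ^ 'p) \<times> (real ^ 'p) \<Rightarrow> bool" where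
  "posterior_exists \<sigma>1 \<sigma>2 \<pi> x \<longleftrightarrow> 0 < marginal \<sigma>1 \<sigma>2 \<pi> x \<and> marginal \<sigma>1 \<sigma>2 \<pi> x < \<infinity>"

definition posterior ::
  "real \<Rightarrow> real \<Rightarrow> ((real ^ 'p) \<times> (real ^ 'p)) measure \<Rightarrow> (real ^ 'p) \<times> (real ^ 'p)
     \<Rightarrow> ((real ^ 'p) \<times> (real ^ 'p)) measure" where
  "posterior \<sigma>1 \<sigma>2 \<pi> x =
     density \<pi> (\<lambda>\<theta>. ennreal (likelihood \<sigma>1 \<sigma>2 x \<theta>) / marginal \<sigma>1 \<sigma>2 \<pi> x)"

definition posterior_risk ::
  "real \<Rightarrow> real \<Rightarrow> real \<Rightarrow> real \<Rightarrow> ((real ^ 'p) \<times> (real ^ 'p)) measure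
     \<Rightarrow> (real ^ 'p) \<times> (real ^ 'p) \<Rightarrow> (real ^ 'p \<Rightarrow> real) \<Rightarrow> ereal" where
  "posterior_risk \<alpha> \<sigma>1 \<sigma>2 \<sigma>Y \<pi> x q =
     ereal_integral (posterior \<sigma>1 \<sigma>2 \<pi> x) (\<lambda>\<theta>. alpha_loss \<alpha> \<sigma>Y (fst \<theta>) q)"

text \<open>\<open>q\<close> minimizes the posterior expected loss at the observation \<open>x\<close>.  The minimum has to be
  finite: if every density has infinite posterior expected loss, minimization singles out nothing.\<close>

definition bayes_predictive ::
  "real \<Rightarrow> real \<Rightarrow> real \<Rightarrow> real \<Rightarrow> ((real ^ 'p) \<times> (real ^ 'p)) measure
     \<Rightarrow> (real ^ 'p) \<times> (real ^ 'p) \<Rightarrow> (real ^ 'p \<Rightarrow> real) \<Rightarrow> bool" where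
  "bayes_predictive \<alpha> \<sigma>1 \<sigma>2 \<sigma>Y \<pi> x q \<longleftrightarrow>
     prob_density q \<and> posterior_risk \<alpha> \<sigma>1 \<sigma>2 \<sigma>Y \<pi> x q < \<infinity> \<and>
     (\<forall>q'. prob_density q' \<longrightarrow>
        posterior_risk \<alpha> \<sigma>1 \<sigma>2 \<sigma>Y \<pi> x q \<le> posterior_risk \<alpha> \<sigma>1 \<sigma>2 \<sigma>Y \<pi> x q')"

text \<open>Taken with respect to \<open>lebesgue\<close>, so that \<open>A\<close> may be any Lebesgue measurable set.\<close>

definition uniform_prior :: "(real ^ 'p) set \<Rightarrow> ((real ^ 'p) \<times> (real ^ 'p)) measure" where
  "uniform_prior A = density lebesgue (\<lambda>\<theta>. indicator A (fst \<theta> - snd \<theta>))"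

text \<open>Predictive densities based on \<open>x1\<close> alone are curried, \<open>q x1 y\<close>.  Equivariance is with respect to
  the translations \<open>(x1, y) \<mapsto> (x1 + a, y + a)\<close>.\<close>

definition equivariant_predictive :: "(real ^ 'p \<Rightarrow> real ^ 'p \<Rightarrow> real) \<Rightarrow> bool" where
  "equivariant_predictive q \<longleftrightarrow>
     (\<forall>x1. prob_density (q x1)) \<and> (\<forall>x1 y a. q (x1 + a) (y + a) = q x1 y)"

definition frequentist_risk ::
  "real \<Rightarrow> real \<Rightarrow> real \<Rightarrow> real ^ 'p \<Rightarrow> (real ^ 'p \<Rightarrow> real ^ 'p \<Rightarrow> real) \<Rightarrow> ereal" where
  "frequentist_risk \<alpha> \<sigma>1 \<sigma>Y \<theta>1 q =
     ereal_integral (density lborel (\<lambda>x1. ennreal (mvn_density \<theta>1 (\<sigma>1\<^sup>2) x1)))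
       (\<lambda>x1. alpha_loss \<alpha> \<sigma>Y \<theta>1 (q x1))"

definition min_risk_equivariant ::
  "real \<Rightarrow> real \<Rightarrow> real \<Rightarrow> (real ^ 'p \<Rightarrow> real ^ 'p \<Rightarrow> real) \<Rightarrow> bool" where
  "min_risk_equivariant \<alpha> \<sigma>1 \<sigma>Y q \<longleftrightarrow>
     equivariant_predictive q \<and>
     (\<forall>q'. equivariant_predictive q' \<longrightarrow>
        (\<forall>\<theta>1. frequentist_risk \<alpha> \<sigma>1 \<sigma>Y \<theta>1 q \<le> frequentist_risk \<alpha> \<sigma>1 \<sigma>Y \<theta>1 q'))"

text \<open>\<open>I(y1; x)\<close>: the probability that a normal vector \<open>T\<close> lies in \<open>A\<close>.\<close>

definition I_factor ::
  "real \<Rightarrow> real \<Rightarrow> real \<Rightarrow> real \<Rightarrow> (real ^ 'p) set \<Rightarrow> (real ^ 'p) \<times> (real ^ 'p) \<Rightarrow> real ^ 'p \<Rightarrow> real"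
  where
  "I_factor \<alpha> \<sigma>1 \<sigma>2 \<sigma>Y A x y =
     (let \<beta> = (1 - \<alpha>) * \<sigma>1\<^sup>2 / ((1 - \<alpha>) * \<sigma>1\<^sup>2 + 2 * \<sigma>Y\<^sup>2);
          \<mu>T = \<beta> *\<^sub>R (y - fst x) + (fst x - snd x);
          vT = 2 * \<sigma>1\<^sup>2 * \<sigma>Y\<^sup>2 / ((1 - \<alpha>) * \<sigma>1\<^sup>2 + 2 * \<sigma>Y\<^sup>2) + \<sigma>2\<^sup>2
      in measure (density lebesgue (\<lambda>t. ennreal (mvn_density \<mu>T vT t))) A)"

end

theory Submission
  imports Defs
begin

text \<open>
  All three optimality claims are about minimizing an averaged loss over densities \<open>q\<close>: a
  probability law \<open>M\<close> produces a random location \<open>t m\<close>, and \<open>q\<close> pays the \<open>\<alpha>\<close>-divergence from the normal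
  density \<open>q\<^sub>m\<close> centred at \<open>t m\<close>.  For Bayes predictive densities \<open>M\<close> is the posterior and \<open>t = fst\<close>.
  For the minimum risk equivariant density, the risk at \<open>\<theta>\<^sub>1\<close> of an equivariant rule \<open>q\<close> is such an
  average for \<open>q 0\<close>, with \<open>M = N(\<theta>\<^sub>1, \<sigma>\<^sub>1\<^sup>2 I)\<close> and \<open>t x\<^sub>1 = \<theta>\<^sub>1 - x\<^sub>1\<close> (lemma \<open>frequentist_risk_eq\<close>).

  The averaged loss satisfies a Pythagorean identity: up to a positive factor and an additive
  constant it is the divergence \<open>D q\<close> of \<open>q\<close> from a single density \<open>r\<close>, and \<open>D q = 0\<close> only if \<open>q = r\<close> almost
  everywhere.  So \<open>r\<close> is the minimizer and it is unique, as soon as the constant is finite.  For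
  \<open>\<alpha> < 1\<close> the density \<open>r\<close> is proportional to the power mean \<open>(\<integral> q\<^sub>m\<^sup>s dM)\<close> to the power \<open>1 / s\<close>, with
  \<open>s = (1 - \<alpha>) / 2\<close> (lemmas \<open>mean_div_power_mean\<close> and \<open>mean_div_mixture\<close>).  For \<open>\<alpha> = 1\<close> it is
  proportional to the geometric mean, the exponential of \<open>\<integral> ln q\<^sub>m dM\<close>; since \<open>ln q\<^sub>m (y)\<close> is quadratic in
  \<open>t m\<close>, this is the normal density centred at the mean of \<open>t\<close> (lemma \<open>mean_div_reverse_kl\<close>), and the
  constant is the variance of \<open>t\<close>, up to scale.

  To keep the identities free of expressions \<open>\<infinity> - \<infinity>\<close>, the loss is rewritten with the integrand
  \<open>h\<^sub>\<alpha>(q / q\<^sub>m) q\<^sub>m - h\<^sub>\<alpha>'(1) (q - q\<^sub>m)\<close>.  The added term integrates to \<open>0\<close> for probability densities, and the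
  new integrand is nonnegative because \<open>h\<^sub>\<alpha>\<close> is convex with \<open>h\<^sub>\<alpha>(1) = 0\<close>.  Everything then takes place in
  the extended nonnegative reals, where Tonelli's theorem applies without integrability conditions.

  It remains to compute the power means.  A power of a normal density is a multiple of a normal
  density with variance divided by the exponent, and products of normal densities are resolved by
  completing the square (lemma \<open>mvn_density_mult\<close>).  Under the uniform prior this yields a normal
  factor in \<open>y\<close>, which gives the minimum risk equivariant density, times the probability that the
  difference of two independent normal vectors lies in \<open>A\<close>, which is \<open>I(y; x)\<close>.
\<close>

section \<open>Isotropic normal densities\<close>

lemma mvn_density_pos: "0 < v \<Longrightarrow> 0 < mvn_density \<mu> v y"
  by (simp add: mvn_density_def)

lemma mvn_density_measurable [measurable]:
  assumes [measurable]: "f \<in> borel_measurable M" "g \<in> borel_measurable M"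
  shows "(\<lambda>x. mvn_density (f x :: real ^ 'p) v (g x)) \<in> borel_measurable M"
  unfolding mvn_density_def by measurable

lemma mvn_density_sym: "mvn_density \<mu> v y = mvn_density y v \<mu>"
  by (simp add: mvn_density_def norm_minus_commute)

lemma mvn_density_shift: "mvn_density \<mu> v (y + a) = mvn_density (\<mu> - a) v y"
  by (simp add: mvn_density_def algebra_simps)

text \<open>Reduces the normalization to the one-dimensional normal density by Fubini over the coordinates.\<close>

lemma mvn_density_eq_prod:
  fixes \<mu> :: "real ^ 'p"
  assumes "0 < v"
  shows "mvn_density \<mu> v y = (\<Prod>b\<in>Basis. normal_density (\<mu> \<bullet> b) (sqrt v) (y \<bullet> b))"
proof -
  have "(norm (y - \<mu>))\<^sup>2 = (\<Sum>b\<in>Basis. (y \<bullet> b - \<mu> \<bullet> b)\<^sup>2)"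
    unfolding power2_norm_eq_inner euclidean_inner[of "y - \<mu>" "y - \<mu>"]
    by (simp add: inner_diff_left power2_eq_square)
  then have 1: "exp (- (norm (y - \<mu>))\<^sup>2 / (2 * v))
      = (\<Prod>b\<in>Basis. exp (- (y \<bullet> b - \<mu> \<bullet> b)\<^sup>2 / (2 * v)))"
    by (simp flip: exp_sum add: sum_divide_distrib sum_negf)
  have "1 / sqrt (2 * pi * v) = (2 * pi * v) powr (- 1 / 2)"
    using assms by (simp add: powr_minus_divide powr_half_sqrt)
  then have 2: "(2 * pi * v) powr (- real CARD('p) / 2) = (\<Prod>b\<in>(Basis :: (real^'p) set). 1 / sqrt (2 * pi * v))"
    using assms by (simp add: powr_powr powr_realpow[symmetric])
  show ?thesis
    unfolding mvn_density_def 1 2 prod.distrib[symmetric]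
    using assms by (simp add: normal_density_def)
qed

lemma nn_integral_mvn_density:
  fixes \<mu> :: "real ^ 'p"
  assumes "0 < v"
  shows "(\<integral>\<^sup>+ y. ennreal (mvn_density \<mu> v y) \<partial>lborel) = 1"
proof -
  have 1: "(\<integral>\<^sup>+ z. ennreal (normal_density m (sqrt v) z) \<partial>lborel) = 1" for m
    using assms by (subst nn_integral_eq_integral) auto
  have "(\<integral>\<^sup>+ y. ennreal (mvn_density \<mu> v y) \<partial>lborel)
      = (\<integral>\<^sup>+ y. (\<Prod>b\<in>Basis. ennreal (normal_density (\<mu> \<bullet> b) (sqrt v) (y \<bullet> b))) \<partial>lborel)"
    using assms by (simp add: mvn_density_eq_prod prod_ennreal)
  also have "\<dots> = (\<Prod>b\<in>(Basis::(real^'p) set). \<integral>\<^sup>+ z. ennreal (normal_density (\<mu> \<bullet> b) (sqrt v) z) \<partial>lborel)"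
    by (rule nn_integral_lborel_prod) auto
  finally show ?thesis by (simp add: 1)
qed

lemma prob_density_mvn_density: "0 < v \<Longrightarrow> prob_density (mvn_density \<mu> v)"
  by (simp add: prob_density_def nn_integral_mvn_density mvn_density_pos less_imp_le)

lemma mvn_density_powr:
  fixes v s :: real
  assumes "0 < v" "0 < s"
  obtains K where "0 < K"
    "\<And>(\<mu> :: real ^ 'p) y. mvn_density \<mu> v y powr s = K * mvn_density \<mu> (v / s) y"
proof
  let ?n = "real CARD('p) / 2"
  show "0 < ((2 * pi * v) powr (- ?n)) powr s / (2 * pi * (v / s)) powr (- ?n)"
    using assms by simp
  fix \<mu> y :: "real ^ 'p"
  show "mvn_density \<mu> v y powr s
      = ((2 * pi * v) powr (- ?n)) powr s / (2 * pi * (v / s)) powr (- ?n) * mvn_density \<mu> (v / s) y"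
    using assms by (simp add: mvn_density_def powr_mult exp_powr_real ac_simps)
qed

text \<open>Completing the square: as a function of \<open>t\<close>, the left-hand side is the unnormalized posterior
  of a location \<open>t\<close> given two normal observations \<open>a\<close> and \<open>b\<close> and a flat prior.  The right-hand side splits off
  the normalized posterior from a factor that depends on the observations alone.\<close>

lemma mvn_density_mult:
  fixes a b t :: "real ^ 'p"
  assumes "0 < v" "0 < w"
  shows "mvn_density a v t * mvn_density b w t
    = mvn_density a (v + w) b * mvn_density ((w / (v + w)) *\<^sub>R a + (v / (v + w)) *\<^sub>R b) (v * w / (v + w)) t"
proof -
  define p where "p = t - a"
  define q where "q = t - b"
  have vw: "v + w \<noteq> 0" using assms by simp
  have "(w / (v + w)) *\<^sub>R t + (v / (v + w)) *\<^sub>R t = t"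
    using vw by (simp flip: scaleR_add_left add_divide_distrib add: add.commute)
  then have m: "t - ((w / (v + w)) *\<^sub>R a + (v / (v + w)) *\<^sub>R b) = (w / (v + w)) *\<^sub>R p + (v / (v + w)) *\<^sub>R q"
    unfolding p_def q_def scaleR_diff_right by (metis add_diff_add)
  have ba: "b - a = p - q" by (simp add: p_def q_def)
  have sq: "(norm p)\<^sup>2 / (2 * v) + (norm q)\<^sup>2 / (2 * w)
      = (norm (p - q))\<^sup>2 / (2 * (v + w))
        + (norm ((w / (v + w)) *\<^sub>R p + (v / (v + w)) *\<^sub>R q))\<^sup>2 / (2 * (v * w / (v + w)))"
  proof -
    define P Q R where "P = p \<bullet> p" and "Q = q \<bullet> q" and "R = p \<bullet> q"
    have "(norm (p - q))\<^sup>2 = P - 2 * R + Q"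
      by (simp add: power2_norm_eq_inner inner_diff_left inner_diff_right P_def Q_def R_def inner_commute)
    moreover have "(norm ((w / (v + w)) *\<^sub>R p + (v / (v + w)) *\<^sub>R q))\<^sup>2
        = (w\<^sup>2 * P + 2 * v * w * R + v\<^sup>2 * Q) / (v + w)\<^sup>2"
      unfolding power2_norm_eq_inner inner_add_left inner_add_right inner_scaleR_left inner_scaleR_right
        inner_commute[of q p] P_def[symmetric] Q_def[symmetric] R_def[symmetric]
      using vw by (simp add: divide_simps power2_eq_square) (simp add: algebra_simps)
    moreover have "P / (2 * v) + Q / (2 * w) = (P - 2 * R + Q) / (2 * (v + w))
        + (w\<^sup>2 * P + 2 * v * w * R + v\<^sup>2 * Q) / (v + w)\<^sup>2 / (2 * (v * w / (v + w)))"
      using assms vw by (simp add: divide_simps power2_eq_square) algebra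
    ultimately show ?thesis by (simp add: P_def Q_def power2_norm_eq_inner)
  qed
  have c: "(2 * pi * v) powr x * (2 * pi * w) powr x
      = (2 * pi * (v + w)) powr x * (2 * pi * (v * w / (v + w))) powr x" for x
  proof -
    have "2 * pi * v * (2 * pi * w) = 2 * pi * (v + w) * (2 * pi * (v * w / (v + w)))"
      using vw by simp
    then show ?thesis unfolding powr_mult[symmetric] by (rule arg_cong)
  qed
  have e: "exp (- (norm p)\<^sup>2 / (2 * v)) * exp (- (norm q)\<^sup>2 / (2 * w))
      = exp (- (norm (p - q))\<^sup>2 / (2 * (v + w)))
        * exp (- (norm ((w / (v + w)) *\<^sub>R p + (v / (v + w)) *\<^sub>R q))\<^sup>2 / (2 * (v * w / (v + w))))"
    using sq by (simp only: minus_divide_left[symmetric] exp_add[symmetric] minus_add_distrib[symmetric])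
  show ?thesis
    unfolding mvn_density_def m ba p_def[symmetric] q_def[symmetric]
    using arg_cong2[OF c[of "- real CARD('p) / 2"] e, of "(*)"] by (simp only: ac_simps)
qed

lemma nn_integral_mvn_density_mult:
  fixes a b :: "real ^ 'p"
  assumes "0 < v" "0 < w"
  shows "(\<integral>\<^sup>+ t. ennreal (mvn_density a v t * mvn_density b w t) \<partial>lborel) = ennreal (mvn_density a (v + w) b)"
  using assms
  by (simp add: mvn_density_mult ennreal_mult' nn_integral_cmult nn_integral_mvn_density
      mvn_density_pos less_imp_le)

text \<open>The quadratic factor is absorbed by doubling the variance, since \<open>x exp (- 2 x) \<le> exp (- x)\<close>.\<close>

lemma nn_integral_mvn_density_second_moment:
  fixes \<mu> :: "real ^ 'p"
  assumes "0 < v"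
  shows "(\<integral>\<^sup>+ y. ennreal ((norm (y - \<mu>))\<^sup>2 * mvn_density \<mu> v y) \<partial>lborel) < \<infinity>"
proof -
  define C where "C = 4 * v * (2 * pi * v) powr (- real CARD('p) / 2) / (2 * pi * (2 * v)) powr (- real CARD('p) / 2)"
  have "0 \<le> C" using assms by (simp add: C_def)
  have "(norm (y - \<mu>))\<^sup>2 * mvn_density \<mu> v y \<le> C * mvn_density \<mu> (2 * v) y" for y
  proof -
    define x where "x = (norm (y - \<mu>))\<^sup>2 / (4 * v)"
    have n: "(norm (y - \<mu>))\<^sup>2 = 4 * v * x" using assms by (simp add: x_def)
    have "x * exp (- 2 * x) \<le> exp x * exp (- 2 * x)"
      by (rule mult_right_mono) (use exp_ge_add_one_self[of x] in \<open>linarith | simp\<close>)+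
    also have "\<dots> = exp (- x)" by (simp flip: exp_add)
    finally have *: "x * exp (- 2 * x) \<le> exp (- x)" .
    have "- (4 * v * x) / (2 * v) = - 2 * x" "- (4 * v * x) / (2 * (2 * v)) = - x"
      using assms by auto
    then show ?thesis
      unfolding mvn_density_def n C_def using assms * by (simp add: mult.commute mult.left_commute)
  qed
  then have "(\<integral>\<^sup>+ y. ennreal ((norm (y - \<mu>))\<^sup>2 * mvn_density \<mu> v y) \<partial>lborel)
      \<le> (\<integral>\<^sup>+ y. ennreal (C * mvn_density \<mu> (2 * v) y) \<partial>lborel)"
    by (intro nn_integral_mono ennreal_leI)
  also have "\<dots> < \<infinity>"
    using assms \<open>0 \<le> C\<close> by (simp add: ennreal_mult' nn_integral_cmult nn_integral_mvn_density)
  finally show ?thesis .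
qed

lemma nn_integral_lborel_shift:
  fixes a :: "'a :: euclidean_space" and f :: "'a \<Rightarrow> ennreal"
  assumes [measurable]: "f \<in> borel_measurable borel"
  shows "(\<integral>\<^sup>+ y. f (y + a) \<partial>lborel) = (\<integral>\<^sup>+ y. f y \<partial>lborel)"
  by (subst (2) lborel_distr_plus[of a, symmetric]) (simp add: nn_integral_distr add.commute)

section \<open>Divergences with a nonnegative integrand\<close>

text \<open>The integrand \<open>h\<^sub>\<alpha>(u / v) v - h\<^sub>\<alpha>'(1) (u - v)\<close> of the divergence of \<open>u\<close> from \<open>v\<close>, in closed form; see
  \<open>h_alpha_tangent\<close>.\<close>

definition pw_div :: "real \<Rightarrow> real \<Rightarrow> real \<Rightarrow> ennreal" where
  "pw_div \<alpha> u v =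
     (if \<alpha> = 1 then ennreal (u * ln (u / v) - u + v)
      else if \<alpha> = - 1 then (if u = 0 then \<infinity> else ennreal (v * ln (v / u) + u - v))
      else ennreal (4 / (1 - \<alpha>\<^sup>2) *
             ((1 + \<alpha>) / 2 * u + (1 - \<alpha>) / 2 * v - u powr ((1 + \<alpha>) / 2) * v powr ((1 - \<alpha>) / 2))))"

lemma pw_div_measurable [measurable]:
  assumes [measurable]: "f \<in> borel_measurable M" "g \<in> borel_measurable M"
  shows "(\<lambda>x. pw_div \<alpha> (f x) (g x)) \<in> borel_measurable M"
  unfolding pw_div_def by measurable

lemma h_alpha_measurable [measurable]:
  assumes [measurable]: "f \<in> borel_measurable M"
  shows "(\<lambda>x. h_alpha \<alpha> (f x)) \<in> borel_measurable M"
  unfolding h_alpha_def by measurable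

text \<open>Both claims are \<open>ln z \<le> z - 1\<close>, with equality only at \<open>z = 1\<close>, taken at \<open>z = v / u\<close>.\<close>

lemma kl_integrand_nonneg:
  fixes u v :: real
  assumes "0 < u" "0 < v"
  shows "0 \<le> u * ln (u / v) - u + v" "u * ln (u / v) - u + v = 0 \<Longrightarrow> u = v"
proof -
  have eq: "u * ln (u / v) - u + v = u * (v / u - 1 - ln (v / u))"
    using assms by (simp add: ln_div algebra_simps)
  show "0 \<le> u * ln (u / v) - u + v"
    unfolding eq using assms ln_le_minus_one[of "v / u"] by (intro mult_nonneg_nonneg) auto
  assume "u * ln (u / v) - u + v = 0"
  then have "ln (v / u) = v / u - 1" unfolding eq using assms by auto
  then have "v / u = 1" using assms by (intro ln_eq_minus_one) auto
  then show "u = v" using assms by simp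
qed

text \<open>Young's inequality with a remainder that settles the case of equality.  Applying the plain
  inequality to \<open>sqrt u\<close> and \<open>sqrt v\<close> and squaring leaves exactly the variance term
  \<open>k s (sqrt u - sqrt v)\<^sup>2\<close> to spare.\<close>

lemma Young_gap:
  fixes k s u v :: real
  assumes "0 < k" "0 < s" "k + s = 1" "0 \<le> u" "0 \<le> v"
  shows "k * s * (sqrt u - sqrt v)\<^sup>2 \<le> k * u + s * v - u powr k * v powr s"
proof -
  have sq: "w powr r = (sqrt w powr r)\<^sup>2" if "0 \<le> w" for w r :: real
    using that by (simp add: power2_eq_square flip: powr_mult)
  have "sqrt u powr k * sqrt v powr s \<le> k * sqrt u + s * sqrt v"
  proof (cases "u = 0 \<or> v = 0")
    case False
    with assms show ?thesis by (intro Youngs_inequality_0) auto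
  qed (use assms in auto)
  then have "(sqrt u powr k * sqrt v powr s)\<^sup>2 \<le> (k * sqrt u + s * sqrt v)\<^sup>2"
    by (intro power_mono) auto
  moreover have "u powr k * v powr s = (sqrt u powr k * sqrt v powr s)\<^sup>2"
    using assms by (simp add: sq[of u] sq[of v] power_mult_distrib)
  moreover have "(k * a + s * b)\<^sup>2 = k * a\<^sup>2 + s * b\<^sup>2 - k * s * (a - b)\<^sup>2" for a b :: real
  proof -
    have "s = 1 - k" using assms by simp
    show ?thesis unfolding \<open>s = 1 - k\<close> by (simp add: power2_eq_square algebra_simps)
  qed
  ultimately show ?thesis using assms by (simp add: real_sqrt_pow2)
qed

lemma pw_div_eq_0_iff:
  assumes "- 1 \<le> \<alpha>" "\<alpha> \<le> 1" "0 \<le> u" "0 < v"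
  shows "pw_div \<alpha> u v = 0 \<longleftrightarrow> u = v"
proof
  show "pw_div \<alpha> u v = 0" if "u = v"
    using that assms
    by (simp add: pw_div_def flip: powr_add distrib_right) (simp add: field_simps)
next
  assume 0: "pw_div \<alpha> u v = 0"
  consider "\<alpha> = 1" | "\<alpha> = - 1" | "- 1 < \<alpha>" "\<alpha> < 1" using assms by fastforce
  then show "u = v"
  proof cases
    case 1
    have "u \<noteq> 0" using 0 1 assms by (auto simp: pw_div_def ennreal_eq_0_iff)
    then have "0 < u" using assms by simp
    with 0 1 assms kl_integrand_nonneg[of u v] show ?thesis
      by (simp add: pw_div_def ennreal_eq_0_iff)
  next
    case 2
    have "u \<noteq> 0" using 0 2 assms by (auto simp: pw_div_def)
    then have "0 < u" using assms by simp
    have "v * ln (v / u) + u - v = 0"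
      using kl_integrand_nonneg(1)[of v u] 0 2 \<open>0 < u\<close> assms by (simp add: pw_div_def ennreal_eq_0_iff)
    with kl_integrand_nonneg(2)[of v u] \<open>0 < u\<close> assms show ?thesis by simp
  next
    case 3
    let ?k = "(1 + \<alpha>) / 2" and ?s = "(1 - \<alpha>) / 2"
    have "\<alpha>\<^sup>2 < 1" using 3 by (simp add: abs_square_less_1)
    have "ennreal (4 / (1 - \<alpha>\<^sup>2) * (?k * u + ?s * v - u powr ?k * v powr ?s)) = 0"
      using 0 3 by (simp only: pw_div_def) (simp split: if_splits)
    then have "4 / (1 - \<alpha>\<^sup>2) * (?k * u + ?s * v - u powr ?k * v powr ?s) \<le> 0"
      by (simp only: ennreal_eq_0_iff)
    moreover have "0 < 4 / (1 - \<alpha>\<^sup>2)" using \<open>\<alpha>\<^sup>2 < 1\<close> by simp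
    ultimately have "?k * u + ?s * v - u powr ?k * v powr ?s \<le> 0"
      by (meson mult_le_0_iff not_less)
    moreover have "?k * ?s * (sqrt u - sqrt v)\<^sup>2 \<le> ?k * u + ?s * v - u powr ?k * v powr ?s"
      using 3 assms by (intro Young_gap) (auto simp: field_simps)
    ultimately have "?k * ?s * (sqrt u - sqrt v)\<^sup>2 \<le> 0" by linarith
    moreover have "0 < ?k * ?s" using 3 by simp
    ultimately have "(sqrt u - sqrt v)\<^sup>2 \<le> 0" by (metis mult_le_0_iff not_less)
    then show ?thesis by simp
  qed
qed

text \<open>Subtracting the tangent of \<open>h\<^sub>\<alpha>\<close> at \<open>1\<close> makes the integrand of the loss nonnegative.  The slope of
  the subtracted tangent is \<open>h\<^sub>\<alpha>'(1) = 1\<close> for \<open>\<alpha> = 1\<close> and \<open>- 2 / (1 - \<alpha>)\<close> otherwise.\<close>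

lemma h_alpha_tangent:
  assumes "- 1 \<le> \<alpha>" "\<alpha> \<le> 1" "0 \<le> u" "0 < v"
  shows "h_alpha \<alpha> (u / v) * ereal v + ereal ((if \<alpha> = 1 then - 1 else 2 / (1 - \<alpha>)) * (u - v))
    = enn2ereal (pw_div \<alpha> u v)"
proof -
  consider "\<alpha> = 1" | "\<alpha> = - 1" | "- 1 < \<alpha>" "\<alpha> < 1" using assms by fastforce
  then show ?thesis
  proof cases
    case 1
    have "0 \<le> u * ln (u / v) - u + v"
      using kl_integrand_nonneg(1)[of u v] assms by (cases "u = 0") auto
    with 1 assms show ?thesis by (simp add: h_alpha_def pw_div_def)
  next
    case 2
    show ?thesis
    proof (cases "u = 0")
      case False
      then have "0 < u" using assms by simp
      with 2 assms kl_integrand_nonneg(1)[of v u] show ?thesis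
        by (simp add: h_alpha_def pw_div_def ln_div algebra_simps)
    qed (use 2 assms in \<open>simp add: h_alpha_def pw_div_def\<close>)
  next
    case 3
    let ?k = "(1 + \<alpha>) / 2" and ?s = "(1 - \<alpha>) / 2"
    have a: "0 < 1 - \<alpha>\<^sup>2" using 3 by (simp add: abs_square_less_1)
    have "?k * ?s * (sqrt u - sqrt v)\<^sup>2 \<le> ?k * u + ?s * v - u powr ?k * v powr ?s"
      using 3 assms by (intro Young_gap) (auto simp: field_simps)
    moreover have "0 \<le> ?k * ?s * (sqrt u - sqrt v)\<^sup>2" using 3 by simp
    ultimately have "0 \<le> ?k * u + ?s * v - u powr ?k * v powr ?s" by linarith
    then have nn: "0 \<le> 4 / (1 - \<alpha>\<^sup>2) * (?k * u + ?s * v - u powr ?k * v powr ?s)"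
      by (rule mult_nonneg_nonneg[rotated]) (use a in simp)
    have "?k + ?s = 1" by (simp add: field_simps)
    then have "v powr ?k * v powr ?s = v" using assms by (simp only: powr_add[symmetric]) simp
    then have "(u / v) powr ?k * v = (u / v) powr ?k * (v powr ?k * v powr ?s)" by simp
    also have "\<dots> = u powr ?k * v powr ?s" using assms by (simp add: powr_divide)
    finally have p: "(u / v) powr ?k * v = u powr ?k * v powr ?s" .
    have c: "2 / (1 - \<alpha>) = 4 / (1 - \<alpha>\<^sup>2) * ?k"
      using 3 a by (simp add: field_simps power2_eq_square)
    have ks: "?s = 1 - ?k" by (simp add: field_simps)
    have "4 / (1 - \<alpha>\<^sup>2) * (1 - (u / v) powr ?k) * v + 2 / (1 - \<alpha>) * (u - v)
        = 4 / (1 - \<alpha>\<^sup>2) * (?k * u + (1 - ?k) * v - (u / v) powr ?k * v)"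
      unfolding c by (simp only: algebra_simps)
    also have "\<dots> = 4 / (1 - \<alpha>\<^sup>2) * (?k * u + ?s * v - u powr ?k * v powr ?s)"
      unfolding p ks ..
    finally show ?thesis using 3 nn by (simp add: h_alpha_def pw_div_def)
  qed
qed

lemma ereal_integral_enn2ereal: "ereal_integral M (\<lambda>x. enn2ereal (F x)) = enn2ereal (\<integral>\<^sup>+ x. F x \<partial>M)"
  by (simp add: ereal_integral_def e2ennreal_neg zero_ennreal.rep_eq)

text \<open>Adding a function with integral \<open>0\<close> does not change an extended integral, even an infinite one.
  If the sum is nonnegative, then \<open>f\<close> has a negative part dominated by the positive part of \<open>g\<close>, so no
  \<open>\<infinity> - \<infinity>\<close> occurs.\<close>

lemma ereal_integral_add_null_integral:
  fixes f :: "'a \<Rightarrow> ereal" and g :: "'a \<Rightarrow> real"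
  assumes [measurable]: "f \<in> borel_measurable M" and d[measurable]: "d \<in> borel_measurable M"
  assumes g: "integrable M g" "(\<integral>x. g x \<partial>M) = 0"
  assumes eq: "\<And>x. x \<in> space M \<Longrightarrow> f x + ereal (g x) = enn2ereal (d x)"
  shows "ereal_integral M f = enn2ereal (\<integral>\<^sup>+ x. d x \<partial>M)"
proof -
  have [measurable]: "g \<in> borel_measurable M" using g by auto
  define Fp Fm Gp Gm where "Fp = (\<integral>\<^sup>+ x. e2ennreal (f x) \<partial>M)" and "Fm = (\<integral>\<^sup>+ x. e2ennreal (- f x) \<partial>M)"
    and "Gp = (\<integral>\<^sup>+ x. ennreal (g x) \<partial>M)" and "Gm = (\<integral>\<^sup>+ x. ennreal (- g x) \<partial>M)"
  have fin: "Gp \<noteq> \<top>" "Gm \<noteq> \<top>"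
    using g(1) by (auto simp: real_integrable_def Gp_def Gm_def)
  have "enn2real Gp = enn2real Gm"
    using g by (simp add: real_lebesgue_integral_def Gp_def Gm_def)
  then have "Gp = Gm" using fin by (metis ennreal_enn2real top.not_eq_extremum)
  have pt: "d x + (e2ennreal (- f x) + ennreal (- g x)) = e2ennreal (f x) + ennreal (g x)
      \<and> e2ennreal (- f x) \<le> ennreal (g x)" if x: "x \<in> space M" for x
  proof (cases "f x")
    case (real r)
    with eq[OF x] have e: "enn2ereal (d x) = ereal (r + g x)" by simp
    then have nn: "0 \<le> r + g x" by (metis ereal_less_eq(5) enn2ereal_nonneg)
    have d: "d x = ennreal (r + g x)" using e by (metis e2ennreal_enn2ereal e2ennreal_ereal)
    show ?thesis
      using nn unfolding d real
      by (cases "0 \<le> r"; cases "0 \<le> g x")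
        (auto simp: ennreal_neg ennreal_le_iff simp flip: ennreal_plus)
  next
    case PInf
    with eq[OF x] have "d x = \<top>" by (metis PInfty_neq_ereal(1) enn2ereal_eq_top_iff plus_ereal.simps(2))
    with PInf show ?thesis by (simp add: e2ennreal_neg)
  next
    case MInf
    with eq[OF x] have "enn2ereal (d x) = - \<infinity>" by simp
    moreover have "0 \<le> enn2ereal (d x)" by simp
    ultimately show ?thesis by simp
  qed
  have "Fm \<le> Gp" unfolding Fm_def Gp_def by (intro nn_integral_mono) (use pt in auto)
  then have "Fm \<noteq> \<top>" using fin by (auto simp: top_unique)
  have "(\<integral>\<^sup>+ x. d x + (e2ennreal (- f x) + ennreal (- g x)) \<partial>M) = (\<integral>\<^sup>+ x. e2ennreal (f x) + ennreal (g x) \<partial>M)"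
    by (intro nn_integral_cong) (use pt in auto)
  then have "(\<integral>\<^sup>+ x. d x \<partial>M) + (Fm + Gm) = Fp + Gp"
    by (simp add: nn_integral_add Fp_def Fm_def Gp_def Gm_def)
  then have "Gm + ((\<integral>\<^sup>+ x. d x \<partial>M) + Fm) = Gm + Fp"
    unfolding \<open>Gp = Gm\<close> by (simp only: ac_simps)
  then have D: "Fp = (\<integral>\<^sup>+ x. d x \<partial>M) + Fm"
    using fin by (simp add: ennreal_add_left_cancel)
  obtain r where r: "Fm = ennreal r" "0 \<le> r" using \<open>Fm \<noteq> \<top>\<close> by (cases Fm) auto
  show ?thesis
    unfolding ereal_integral_def Fp_def[symmetric] Fm_def[symmetric]
    unfolding D plus_ennreal.rep_eq r(1) enn2ereal_ennreal[OF r(2)]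
    by (cases "enn2ereal (\<integral>\<^sup>+ x. d x \<partial>M)") auto
qed

lemma prob_density_integrable:
  assumes "prob_density q"
  shows "integrable lborel q" "(\<integral>y. q y \<partial>lborel) = 1"
proof -
  have [measurable]: "q \<in> borel_measurable borel" and "\<And>y. 0 \<le> q y" "(\<integral>\<^sup>+ y. ennreal (q y) \<partial>lborel) = 1"
    using assms by (auto simp: prob_density_def)
  then show "integrable lborel q" "(\<integral>y. q y \<partial>lborel) = 1"
    by (auto simp: integrable_iff_bounded integral_eq_nn_integral)
qed

lemma alpha_loss_eq:
  fixes q :: "real ^ 'p \<Rightarrow> real"
  assumes "- 1 \<le> \<alpha>" "\<alpha> \<le> 1" "0 < \<sigma>Y" "prob_density q"
  shows "alpha_loss \<alpha> \<sigma>Y \<theta> q = enn2ereal (\<integral>\<^sup>+ y. pw_div \<alpha> (q y) (mvn_density \<theta> (\<sigma>Y\<^sup>2) y) \<partial>lborel)"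
proof -
  have [measurable]: "q \<in> borel_measurable borel" and nn: "\<And>y. 0 \<le> q y"
    using assms by (auto simp: prob_density_def)
  have pos: "0 < mvn_density \<theta> (\<sigma>Y\<^sup>2) y" for y using assms by (simp add: mvn_density_pos)
  have "prob_density (mvn_density \<theta> (\<sigma>Y\<^sup>2))" using assms by (simp add: prob_density_mvn_density)
  note i = prob_density_integrable[OF this] prob_density_integrable[OF assms(4)]
  show ?thesis
    unfolding alpha_loss_def
    by (rule ereal_integral_add_null_integral[where
          g = "\<lambda>y. (if \<alpha> = 1 then - 1 else 2 / (1 - \<alpha>)) * (q y - mvn_density \<theta> (\<sigma>Y\<^sup>2) y)"])
      (use i h_alpha_tangent[OF assms(1,2) nn pos] in auto)
qed

section \<open>Pythagorean identities for averaged divergences, \<open>\<alpha> < 1\<close>\<close>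

text \<open>The loss of \<open>q\<close>, averaged over a location \<open>t m\<close> with \<open>m\<close> distributed as \<open>M\<close>; \<open>v\<close> is the variance of
  the density to be predicted.\<close>

definition mean_div ::
  "real \<Rightarrow> real \<Rightarrow> 'm measure \<Rightarrow> ('m \<Rightarrow> real ^ 'p) \<Rightarrow> (real ^ 'p \<Rightarrow> real) \<Rightarrow> ennreal" where
  "mean_div \<alpha> v M t q = (\<integral>\<^sup>+ m. \<integral>\<^sup>+ y. pw_div \<alpha> (q y) (mvn_density (t m) v y) \<partial>lborel \<partial>M)"

text \<open>The loss with a fixed density \<open>r\<close> in place of the unknown one: what the averaged loss of \<open>q\<close> exceeds its
  minimum by, up to a factor, when \<open>r\<close> is the minimizer.\<close>

definition div_from :: "real \<Rightarrow> (real ^ 'p \<Rightarrow> real) \<Rightarrow> (real ^ 'p \<Rightarrow> real) \<Rightarrow> ennreal" where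
  "div_from \<alpha> r q = (\<integral>\<^sup>+ y. pw_div \<alpha> (q y) (r y) \<partial>lborel)"

lemma mean_div_swap:
  fixes t :: "'m \<Rightarrow> real ^ 'p"
  assumes "prob_space M" and [measurable]: "t \<in> borel_measurable M" "q \<in> borel_measurable borel"
  shows "mean_div \<alpha> v M t q = (\<integral>\<^sup>+ y. \<integral>\<^sup>+ m. pw_div \<alpha> (q y) (mvn_density (t m) v y) \<partial>M \<partial>lborel)"
proof -
  interpret prob_space M by fact
  interpret pair_sigma_finite lborel M ..
  show ?thesis unfolding mean_div_def by (rule Fubini') measurable
qed

lemma nn_integral_mixture:
  fixes t :: "'m \<Rightarrow> real ^ 'p"
  assumes "prob_space M" and [measurable]: "t \<in> borel_measurable M" and "0 < v"
  shows "(\<integral>\<^sup>+ y. \<integral>\<^sup>+ m. ennreal (mvn_density (t m) v y) \<partial>M \<partial>lborel) = 1"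
proof -
  interpret prob_space M by fact
  interpret pair_sigma_finite M lborel ..
  have "(\<integral>\<^sup>+ y. \<integral>\<^sup>+ m. ennreal (mvn_density (t m) v y) \<partial>M \<partial>lborel)
      = (\<integral>\<^sup>+ m. \<integral>\<^sup>+ y. ennreal (mvn_density (t m) v y) \<partial>lborel \<partial>M)"
    by (rule Fubini') measurable
  then show ?thesis using assms by (simp add: nn_integral_mvn_density emeasure_space_1)
qed

lemma div_from_eq_0_iff:
  assumes "- 1 \<le> \<alpha>" "\<alpha> \<le> 1" "prob_density q" "\<And>y. 0 < r y" and [measurable]: "r \<in> borel_measurable borel"
  shows "div_from \<alpha> r q = 0 \<longleftrightarrow> (AE y in lborel. q y = r y)"
proof -
  have [measurable]: "q \<in> borel_measurable borel" and "\<And>y. 0 \<le> q y"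
    using assms by (auto simp: prob_density_def)
  then show ?thesis
    unfolding div_from_def by (subst nn_integral_0_iff_AE) (auto simp: pw_div_eq_0_iff assms)
qed

text \<open>With \<open>k = 1 - s\<close>, the averaged integrand is \<open>k q + s E q\<^sub>m - q\<^sup>k E q\<^sub>m\<^sup>s\<close> up to a factor, where \<open>E\<close> is the mean over
  \<open>M\<close>.  So it depends on the family \<open>q\<^sub>m\<close>, apart from a term that integrates to a constant, only through
  \<open>E q\<^sub>m\<^sup>s = C r\<^sup>s\<close>, which is what the integrand of the divergence from \<open>r\<close> contains as well.\<close>

lemma mean_div_power_mean:
  fixes t :: "'m \<Rightarrow> real ^ 'p"
  assumes \<alpha>: "- 1 < \<alpha>" "\<alpha> < 1"
    and M: "prob_space M" and t[measurable]: "t \<in> borel_measurable M" and "0 < v" "0 \<le> C"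
    and r: "prob_density r"
    and E: "\<And>y. (\<integral>\<^sup>+ m. ennreal (mvn_density (t m) v y powr ((1 - \<alpha>) / 2)) \<partial>M) = ennreal (C * r y powr ((1 - \<alpha>) / 2))"
    and q: "prob_density q"
  shows "mean_div \<alpha> v M t q + ennreal (4 / (1 - \<alpha>\<^sup>2)) * ennreal C
    = ennreal (4 / (1 - \<alpha>\<^sup>2)) + ennreal C * div_from \<alpha> r q"
proof -
  interpret prob_space M by fact
  interpret pair_sigma_finite lborel M ..
  have [measurable]: "q \<in> borel_measurable borel" "r \<in> borel_measurable borel"
    and nn: "\<And>y. 0 \<le> q y" "\<And>y. 0 \<le> r y"
    and one: "(\<integral>\<^sup>+ y. ennreal (q y) \<partial>lborel) = 1" "(\<integral>\<^sup>+ y. ennreal (r y) \<partial>lborel) = 1"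
    using q r by (auto simp: prob_density_def)
  define k s c where "k = (1 + \<alpha>) / 2" and "s = (1 - \<alpha>) / 2" and "c = 4 / (1 - \<alpha>\<^sup>2)"
  have ks: "0 < k" "0 < s" "k + s = 1" using \<alpha> by (auto simp: k_def s_def field_simps)
  have c: "0 < c" using \<alpha> by (simp add: c_def abs_square_less_1)
  have young: "pw_div \<alpha> u w + ennreal (c * u powr k) * ennreal (w powr s)
      = ennreal (c * k * u) + ennreal (c * s) * ennreal w" if "0 \<le> u" "0 \<le> w" for u w
  proof -
    have "0 \<le> k * s * (sqrt u - sqrt w)\<^sup>2" using ks by simp
    with Young_gap[OF ks that] have "0 \<le> k * u + s * w - u powr k * w powr s" by linarith
    then have p: "0 \<le> c * (k * u + s * w - u powr k * w powr s)" using c by simp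
    have "pw_div \<alpha> u w = ennreal (c * (k * u + s * w - u powr k * w powr s))"
      using \<alpha> by (simp add: pw_div_def c_def k_def s_def)
    moreover have "ennreal (c * (k * u + s * w - u powr k * w powr s)) + ennreal (c * u powr k * w powr s)
        = ennreal (c * k * u + c * s * w)"
      using c that by (subst ennreal_plus[OF p, symmetric]) (auto simp: algebra_simps)
    ultimately show ?thesis
      using c ks that by (simp add: ennreal_mult[symmetric])
  qed
  \<comment> \<open>Adding \<open>X\<close> cancels the product in Young's inequality, on average over \<open>M\<close> and, by the choice of \<open>r\<close>,
    also in the divergence from \<open>r\<close>.\<close>
  have pt: "(\<integral>\<^sup>+ m. pw_div \<alpha> (q y) (mvn_density (t m) v y) \<partial>M) + ennreal C * (ennreal (c * k * q y) + ennreal (c * s) * ennreal (r y))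
      = ennreal (c * k * q y) + ennreal (c * s) * (\<integral>\<^sup>+ m. ennreal (mvn_density (t m) v y) \<partial>M)
        + ennreal C * pw_div \<alpha> (q y) (r y)" (is "?L + ennreal C * ?Z = ?R + _") for y
  proof -
    define X where "X = ennreal (c * q y powr k) * ennreal (C * r y powr s)"
    have "(\<integral>\<^sup>+ m. pw_div \<alpha> (q y) (mvn_density (t m) v y) + ennreal (c * q y powr k) * ennreal (mvn_density (t m) v y powr s) \<partial>M)
        = (\<integral>\<^sup>+ m. ennreal (c * k * q y) + ennreal (c * s) * ennreal (mvn_density (t m) v y) \<partial>M)"
      using nn \<open>0 < v\<close> by (simp add: young mvn_density_pos less_imp_le)
    then have 1: "?L + X = ?R"
      using E[of y] by (simp add: nn_integral_add nn_integral_cmult emeasure_space_1 X_def s_def)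
    have 2: "ennreal C * pw_div \<alpha> (q y) (r y) + X = ennreal C * ?Z"
      using \<open>0 \<le> C\<close> nn unfolding young[OF nn(1)[of y] nn(2)[of y], symmetric] X_def
      by (simp add: distrib_left ennreal_mult ac_simps)
    show ?thesis unfolding 1[symmetric] 2[symmetric] by (simp only: ac_simps)
  qed
  have "(\<integral>\<^sup>+ y. (\<integral>\<^sup>+ m. pw_div \<alpha> (q y) (mvn_density (t m) v y) \<partial>M) + ennreal C * (ennreal (c * k * q y) + ennreal (c * s) * ennreal (r y)) \<partial>lborel)
      = mean_div \<alpha> v M t q + ennreal C * (ennreal (c * k) + ennreal (c * s))"
    using c ks nn by (simp add: mean_div_swap[OF M] nn_integral_add nn_integral_cmult ennreal_mult'[of "c * k"] one)
  moreover have "(\<integral>\<^sup>+ y. ennreal (c * k * q y) + ennreal (c * s) * (\<integral>\<^sup>+ m. ennreal (mvn_density (t m) v y) \<partial>M)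
        + ennreal C * pw_div \<alpha> (q y) (r y) \<partial>lborel)
      = ennreal (c * k) + ennreal (c * s) + ennreal C * div_from \<alpha> r q"
    using c ks nn by (simp add: div_from_def nn_integral_add nn_integral_cmult ennreal_mult'[of "c * k"] one
        nn_integral_mixture[OF M t \<open>0 < v\<close>])
  moreover have "ennreal (c * k) + ennreal (c * s) = ennreal c"
    using c ks by (simp flip: ennreal_plus distrib_left)
  ultimately show ?thesis unfolding pt c_def[symmetric] by (simp add: mult.commute)
qed

text \<open>Transfers an identity between reals, one of which has unknown sign, to \<open>ennreal\<close>.\<close>

lemma ennreal_add_pos_neg_part:
  fixes a b g :: real
  assumes "0 \<le> a" "0 \<le> b" "a + g = b"
  shows "ennreal a + ennreal g = ennreal b + ennreal (- g)"
proof (cases "0 \<le> g")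
  case False
  then have "a = b + - g" "0 \<le> - g" using assms by auto
  then have "ennreal a = ennreal b + ennreal (- g)" using assms(2) by (simp only: ennreal_plus)
  then show ?thesis using False by (simp add: ennreal_neg)
qed (use assms in \<open>auto simp: ennreal_neg\<close>)

text \<open>The Kullback-Leibler integrands of \<open>u\<close> and \<open>z\<close> against \<open>w\<close> differ by \<open>w ln (z / u) + u - z\<close>, which is affine
  in \<open>w\<close> and can therefore be averaged over \<open>w\<close>.  The difference is distributed over both sides
  according to sign.\<close>

lemma pw_div_kl_change_density:
  assumes pos: "0 < u" "0 < z" "0 < w"
  shows "pw_div (- 1) u w + (ennreal w * ennreal (ln (u / z)) + ennreal z)
      = pw_div (- 1) z w + (ennreal w * ennreal (ln (z / u)) + ennreal u)"
proof -
  have e: "pw_div (- 1) a w = ennreal (w * ln (w / a) - w + a)" "0 \<le> w * ln (w / a) - w + a" if "0 < a" for a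
    using that pos(3) kl_integrand_nonneg(1)[of w a] by (auto simp: pw_div_def algebra_simps)
  define A B where "A = w * ln (w / u) - w + u" and "B = w * ln (w / z) - w + z"
  have AB: "A + w * ln (u / z) + z = B + u" "ln (z / u) = - ln (u / z)"
    using pos by (simp_all add: A_def B_def ln_div algebra_simps)
  have AB0: "0 \<le> A" "0 \<le> B" using e pos by (simp_all add: A_def B_def)
  have sum: "ennreal (A + z) + ennreal (w * ln (u / z)) = ennreal (B + u) + ennreal (- (w * ln (u / z)))"
    using pos AB(1) AB0 by (intro ennreal_add_pos_neg_part) auto
  have w: "ennreal w * ennreal g = ennreal (w * g)" for g
    by (rule ennreal_mult'[symmetric]) (use pos in simp)
  have z: "ennreal (A + z) = ennreal A + ennreal z" and u: "ennreal (B + u) = ennreal B + ennreal u"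
    using pos AB0 by simp_all
  show ?thesis
    unfolding e(1)[OF pos(1)] e(1)[OF pos(2)] A_def[symmetric] B_def[symmetric] AB(2) w mult_minus_right
    using sum unfolding z u by (simp only: ac_simps)
qed

text \<open>The compensation identity of Kullback-Leibler divergence.  It is stated separately from the case
  \<open>- 1 < \<alpha>\<close> because the averaged loss of the mixture \<open>r\<close> itself enters as a term, which need not be
  finite.\<close>

lemma mean_div_mixture:
  fixes t :: "'m \<Rightarrow> real ^ 'p"
  assumes M: "prob_space M" and t[measurable]: "t \<in> borel_measurable M" and "0 < v"
    and r: "prob_density r" "\<And>y. 0 < r y"
    and E: "\<And>y. (\<integral>\<^sup>+ m. ennreal (mvn_density (t m) v y) \<partial>M) = ennreal (r y)"
    and q: "prob_density q"
  shows "mean_div (- 1) v M t q = mean_div (- 1) v M t r + div_from (- 1) r q"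
proof -
  have [measurable]: "q \<in> borel_measurable borel" "r \<in> borel_measurable borel"
    and nn: "\<And>y. 0 \<le> q y"
    using q r by (auto simp: prob_density_def)
  have pt: "(\<integral>\<^sup>+ m. pw_div (- 1) (q y) (mvn_density (t m) v y) \<partial>M)
      = (\<integral>\<^sup>+ m. pw_div (- 1) (r y) (mvn_density (t m) v y) \<partial>M) + pw_div (- 1) (q y) (r y)" for y
  proof (cases "q y = 0")
    case True
    then show ?thesis using prob_space.emeasure_space_1[OF M] by (simp add: pw_div_def)
  next
    case False
    then have "0 < q y" using nn[of y] by simp
    \<comment> \<open>The mixture has density \<open>r\<close>, so replacing \<open>q y\<close> by \<open>r y\<close> changes the averaged integrand and the integrand
      against \<open>r\<close> by the same pair of terms.\<close>
    define X Y where "X = ennreal (r y) * ennreal (ln (q y / r y)) + ennreal (r y)"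
      and "Y = ennreal (r y) * ennreal (ln (r y / q y)) + ennreal (q y)"
    have X: "X \<noteq> \<infinity>" by (simp add: X_def ennreal_mult_eq_top_iff)
    have "(\<integral>\<^sup>+ m. pw_div (- 1) (q y) (mvn_density (t m) v y)
          + (ennreal (mvn_density (t m) v y) * ennreal (ln (q y / r y)) + ennreal (r y)) \<partial>M)
        = (\<integral>\<^sup>+ m. pw_div (- 1) (r y) (mvn_density (t m) v y)
          + (ennreal (mvn_density (t m) v y) * ennreal (ln (r y / q y)) + ennreal (q y)) \<partial>M)"
      using r \<open>0 < q y\<close> \<open>0 < v\<close> by (simp add: pw_div_kl_change_density mvn_density_pos)
    then have 1: "(\<integral>\<^sup>+ m. pw_div (- 1) (q y) (mvn_density (t m) v y) \<partial>M) + X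
        = (\<integral>\<^sup>+ m. pw_div (- 1) (r y) (mvn_density (t m) v y) \<partial>M) + Y"
      using E[of y] prob_space.emeasure_space_1[OF M]
      by (simp add: nn_integral_add nn_integral_multc X_def Y_def)
    have "pw_div (- 1) (r y) (r y) = 0" using r by (simp add: pw_div_eq_0_iff less_imp_le)
    then have 2: "pw_div (- 1) (q y) (r y) + X = Y"
      using pw_div_kl_change_density[of "q y" "r y" "r y"] r \<open>0 < q y\<close> by (simp add: X_def Y_def)
    have "X + (\<integral>\<^sup>+ m. pw_div (- 1) (q y) (mvn_density (t m) v y) \<partial>M)
        = X + ((\<integral>\<^sup>+ m. pw_div (- 1) (r y) (mvn_density (t m) v y) \<partial>M) + pw_div (- 1) (q y) (r y))"
      using 1 unfolding 2[symmetric] by (simp only: ac_simps)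
    then show ?thesis using X by (simp add: ennreal_add_left_cancel)
  qed
  show ?thesis
    by (simp add: mean_div_swap[OF M] pt nn_integral_add div_from_def
        sigma_finite_measure.borel_measurable_nn_integral[OF prob_space_imp_sigma_finite[OF M]])
qed

text \<open>Since \<open>r\<close> is optimal, it suffices to exhibit one density of finite averaged loss.  A normal density
  with the variance of the components does: its log-ratio with each component is at most quadratic in
  \<open>y\<close>, uniformly over the locations, so only the second moment of \<open>r\<close> matters.\<close>

lemma mean_div_mixture_finite:
  fixes t :: "'m \<Rightarrow> real ^ 'p"
  assumes M: "prob_space M" and t[measurable]: "t \<in> borel_measurable M" and "0 < v"
    and r: "prob_density r" "\<And>y. 0 < r y"
    and E: "\<And>y. (\<integral>\<^sup>+ m. ennreal (mvn_density (t m) v y) \<partial>M) = ennreal (r y)"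
    and fin: "(\<integral>\<^sup>+ y. ennreal ((norm (y - a))\<^sup>2 * r y) \<partial>lborel) < \<infinity>"
  shows "mean_div (- 1) v M t r < \<infinity>"
proof -
  have [measurable]: "r \<in> borel_measurable borel" using r by (auto simp: prob_density_def)
  have "pw_div (- 1) (mvn_density a v y) (mvn_density b v y)
      \<le> ennreal ((norm (y - a))\<^sup>2 / (2 * v)) * ennreal (mvn_density b v y) + ennreal (mvn_density a v y)" for b y :: "real ^ 'p"
  proof -
    have pos: "0 < mvn_density a v y" "0 < mvn_density b v y" using \<open>0 < v\<close> by (auto simp: mvn_density_pos)
    have "ln (mvn_density b v y / mvn_density a v y) = ((norm (y - a))\<^sup>2 - (norm (y - b))\<^sup>2) / (2 * v)"
      using \<open>0 < v\<close> by (simp add: mvn_density_def ln_div ln_mult diff_divide_distrib)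
    also have "\<dots> \<le> (norm (y - a))\<^sup>2 / (2 * v)" using \<open>0 < v\<close> by (simp add: divide_right_mono)
    finally have "mvn_density b v y * ln (mvn_density b v y / mvn_density a v y)
        \<le> mvn_density b v y * ((norm (y - a))\<^sup>2 / (2 * v))"
      using pos by (intro mult_left_mono) auto
    then have "mvn_density b v y * ln (mvn_density b v y / mvn_density a v y) + mvn_density a v y - mvn_density b v y
        \<le> (norm (y - a))\<^sup>2 / (2 * v) * mvn_density b v y + mvn_density a v y"
      using pos by (simp add: mult.commute)
    then have "pw_div (- 1) (mvn_density a v y) (mvn_density b v y)
        \<le> ennreal ((norm (y - a))\<^sup>2 / (2 * v) * mvn_density b v y + mvn_density a v y)"
      using pos by (simp add: pw_div_def ennreal_leI)
    also have "\<dots> = ennreal ((norm (y - a))\<^sup>2 / (2 * v)) * ennreal (mvn_density b v y) + ennreal (mvn_density a v y)"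
      using pos \<open>0 < v\<close> by (subst ennreal_plus) (simp_all only: ennreal_mult divide_nonneg_pos zero_le_power2 less_imp_le mult_nonneg_nonneg zero_less_mult_iff zero_less_numeral simp_thms)
    finally show ?thesis .
  qed
  then have "mean_div (- 1) v M t (mvn_density a v)
      \<le> (\<integral>\<^sup>+ y. \<integral>\<^sup>+ m. ennreal ((norm (y - a))\<^sup>2 / (2 * v)) * ennreal (mvn_density (t m) v y)
            + ennreal (mvn_density a v y) \<partial>M \<partial>lborel)"
    by (subst mean_div_swap[OF M]) (auto intro!: nn_integral_mono)
  also have "\<dots> = (\<integral>\<^sup>+ y. ennreal (1 / (2 * v)) * ennreal ((norm (y - a))\<^sup>2 * r y) + ennreal (mvn_density a v y) \<partial>lborel)"
    using E prob_space.emeasure_space_1[OF M] \<open>0 < v\<close> r(2)[THEN less_imp_le]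
    by (simp add: nn_integral_add nn_integral_cmult flip: ennreal_mult)
  also have "\<dots> < \<infinity>"
    using \<open>0 < v\<close> fin by (simp add: nn_integral_add nn_integral_cmult nn_integral_mvn_density ennreal_mult_less_top)
  finally have "mean_div (- 1) v M t (mvn_density a v) < \<infinity>" .
  then show ?thesis
    unfolding mean_div_mixture[OF M t \<open>0 < v\<close> r E prob_density_mvn_density[OF \<open>0 < v\<close>]] by simp
qed

section \<open>The Pythagorean identity for reverse Kullback-Leibler divergence\<close>

text \<open>Replacing \<open>q\<^sub>m\<close> by the normal density centred at \<open>c\<close> changes \<open>q ln (q / q\<^sub>m)\<close> by a multiple of
  \<open>|y - t m|\<^sup>2 - |y - c|\<^sup>2\<close>, whose mean over \<open>M\<close> is the variance of \<open>t\<close> and free of \<open>y\<close>.  The identity includes the case of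
  infinite variance, in which every density has infinite averaged loss.\<close>

lemma mean_div_reverse_kl:
  fixes t :: "'m \<Rightarrow> real ^ 'p"
  assumes M: "prob_space M" and t: "integrable M t" and "0 < v" and q: "prob_density q"
  defines "c \<equiv> (\<integral>m. t m \<partial>M)"
  shows "mean_div 1 v M t q = div_from 1 (mvn_density c v) q
    + (\<integral>\<^sup>+ m. ennreal ((norm (t m - c))\<^sup>2 / (2 * v)) \<partial>M)"
proof -
  interpret prob_space M by fact
  have [measurable]: "t \<in> borel_measurable M" using t by auto
  have [measurable]: "q \<in> borel_measurable borel" and nn: "\<And>y. 0 \<le> q y"
    and one: "(\<integral>\<^sup>+ y. ennreal (q y) \<partial>lborel) = 1"
    using q by (auto simp: prob_density_def)
  define W where "W = (\<integral>\<^sup>+ m. ennreal ((norm (t m - c))\<^sup>2 / (2 * v)) \<partial>M)"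
  \<comment> \<open>The parallel axis identity; with a possibly infinite variance \<open>W\<close> it has to be proved by splitting the
    cross term, whose integral vanishes, into its positive and negative part.\<close>
  have steiner: "(\<integral>\<^sup>+ m. ennreal ((norm (y - t m))\<^sup>2 / (2 * v)) \<partial>M) = ennreal ((norm (y - c))\<^sup>2 / (2 * v)) + W" for y
  proof -
    define g where "g m = ((y - c) \<bullet> (t m - c)) / v" for m
    have g: "integrable M g"
      using t unfolding g_def by (intro integrable_divide_zero integrable_inner_right) auto
    then have [measurable]: "g \<in> borel_measurable M" by auto
    have "(\<integral>m. (y - c) \<bullet> (t m - c) \<partial>M) = (y - c) \<bullet> (\<integral>m. t m - c \<partial>M)"
      using t by (intro integral_inner_right) auto
    also have "(\<integral>m. t m - c \<partial>M) = 0"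
      using t prob_space by (simp add: c_def)
    finally have "(\<integral>m. g m \<partial>M) = 0" by (simp add: g_def)
    define Gp Gm where "Gp = (\<integral>\<^sup>+ m. ennreal (g m) \<partial>M)" and "Gm = (\<integral>\<^sup>+ m. ennreal (- g m) \<partial>M)"
    have fin: "Gp \<noteq> \<infinity>" "Gm \<noteq> \<infinity>" using g by (auto simp: real_integrable_def Gp_def Gm_def)
    have "enn2real Gp = enn2real Gm"
      using g \<open>(\<integral>m. g m \<partial>M) = 0\<close> by (simp add: real_lebesgue_integral_def Gp_def Gm_def)
    then have "Gp = Gm" using fin by (metis ennreal_enn2real infinity_ennreal_def top.not_eq_extremum)
    have sq: "(norm (y - t m))\<^sup>2 / (2 * v) + g m = (norm (y - c))\<^sup>2 / (2 * v) + (norm (t m - c))\<^sup>2 / (2 * v)" for m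
    proof -
      have "(norm (y - t m))\<^sup>2 = (norm ((y - c) - (t m - c)))\<^sup>2" by simp
      also have "\<dots> = (norm (y - c))\<^sup>2 + (norm (t m - c))\<^sup>2 - 2 * ((y - c) \<bullet> (t m - c))"
        unfolding power2_norm_eq_inner by (simp only: inner_diff_left inner_diff_right inner_commute) simp
      finally show ?thesis using \<open>0 < v\<close> by (simp add: g_def field_simps)
    qed
    have "ennreal ((norm (y - t m))\<^sup>2 / (2 * v)) + ennreal (g m)
        = ennreal ((norm (y - c))\<^sup>2 / (2 * v)) + ennreal ((norm (t m - c))\<^sup>2 / (2 * v)) + ennreal (- g m)" for m
      using ennreal_add_pos_neg_part[OF _ _ sq[of m]] \<open>0 < v\<close> by simp
    then have "(\<integral>\<^sup>+ m. ennreal ((norm (y - t m))\<^sup>2 / (2 * v)) + ennreal (g m) \<partial>M)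
        = (\<integral>\<^sup>+ m. ennreal ((norm (y - c))\<^sup>2 / (2 * v)) + ennreal ((norm (t m - c))\<^sup>2 / (2 * v)) + ennreal (- g m) \<partial>M)"
      by simp
    then have "Gm + (\<integral>\<^sup>+ m. ennreal ((norm (y - t m))\<^sup>2 / (2 * v)) \<partial>M) = Gm + (ennreal ((norm (y - c))\<^sup>2 / (2 * v)) + W)"
      by (simp add: nn_integral_add emeasure_space_1 W_def Gp_def[symmetric] Gm_def[symmetric] \<open>Gp = Gm\<close> ac_simps)
    then show ?thesis using fin by (simp add: ennreal_add_left_cancel)
  qed
  have kl: "pw_div 1 u (mvn_density b v y) + (ennreal (mvn_density c v y) + ennreal u * ennreal ((norm (y - c))\<^sup>2 / (2 * v)))
      = pw_div 1 u (mvn_density c v y) + (ennreal (mvn_density b v y) + ennreal u * ennreal ((norm (y - b))\<^sup>2 / (2 * v)))"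
    if "0 \<le> u" for u b y
  proof -
    have pos: "0 < mvn_density c v y" "0 < mvn_density b v y" using \<open>0 < v\<close> by (auto simp: mvn_density_pos)
    have p: "0 \<le> u * ln (u / w) - u + w" if "0 < w" for w
      using that kl_integrand_nonneg(1)[of u w] \<open>0 \<le> u\<close> by (cases "u = 0") auto
    have "u * ln (u / mvn_density b v y) + u * ((norm (y - c))\<^sup>2 / (2 * v))
        = u * ln (u / mvn_density c v y) + u * ((norm (y - b))\<^sup>2 / (2 * v))"
    proof (cases "u = 0")
      case False
      then show ?thesis
        using \<open>0 < v\<close> \<open>0 \<le> u\<close> by (simp add: mvn_density_def ln_div ln_mult algebra_simps)
    qed simp
    then have "(u * ln (u / mvn_density b v y) - u + mvn_density b v y) + (mvn_density c v y + u * ((norm (y - c))\<^sup>2 / (2 * v)))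
       = (u * ln (u / mvn_density c v y) - u + mvn_density c v y) + (mvn_density b v y + u * ((norm (y - b))\<^sup>2 / (2 * v)))"
      by linarith
    then show ?thesis
      using p[OF pos(1)] p[OF pos(2)] pos that \<open>0 < v\<close>
      by (simp add: pw_div_def flip: ennreal_plus ennreal_mult)
  qed
  have pt: "(\<integral>\<^sup>+ m. pw_div 1 (q y) (mvn_density (t m) v y) \<partial>M) + ennreal (mvn_density c v y)
      = pw_div 1 (q y) (mvn_density c v y) + (\<integral>\<^sup>+ m. ennreal (mvn_density (t m) v y) \<partial>M) + ennreal (q y) * W"
    (is "?L = ?R") for y
  proof -
    define X where "X = ennreal (q y) * ennreal ((norm (y - c))\<^sup>2 / (2 * v))"
    have X: "X \<noteq> \<infinity>" by (simp add: X_def ennreal_mult_eq_top_iff)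
    have "(\<integral>\<^sup>+ m. pw_div 1 (q y) (mvn_density (t m) v y) + (ennreal (mvn_density c v y) + X) \<partial>M)
        = (\<integral>\<^sup>+ m. pw_div 1 (q y) (mvn_density c v y) + (ennreal (mvn_density (t m) v y)
            + ennreal (q y) * ennreal ((norm (y - t m))\<^sup>2 / (2 * v))) \<partial>M)"
      unfolding X_def kl[OF nn] ..
    then have "(\<integral>\<^sup>+ m. pw_div 1 (q y) (mvn_density (t m) v y) \<partial>M) + (ennreal (mvn_density c v y) + X)
        = pw_div 1 (q y) (mvn_density c v y) + ((\<integral>\<^sup>+ m. ennreal (mvn_density (t m) v y) \<partial>M)
            + ennreal (q y) * (\<integral>\<^sup>+ m. ennreal ((norm (y - t m))\<^sup>2 / (2 * v)) \<partial>M))"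
      by (simp add: nn_integral_add nn_integral_cmult emeasure_space_1)
    then have "X + ?L = X + ?R"
      unfolding steiner distrib_left X_def[symmetric] by (simp only: ac_simps)
    then show ?thesis using X by (simp add: ennreal_add_left_cancel)
  qed
  have "(\<integral>\<^sup>+ y. (\<integral>\<^sup>+ m. pw_div 1 (q y) (mvn_density (t m) v y) \<partial>M) + ennreal (mvn_density c v y) \<partial>lborel)
      = 1 + mean_div 1 v M t q"
    using \<open>0 < v\<close> by (simp add: nn_integral_add mean_div_swap[OF M] nn_integral_mvn_density add.commute)
  moreover have "(\<integral>\<^sup>+ y. pw_div 1 (q y) (mvn_density c v y) + (\<integral>\<^sup>+ m. ennreal (mvn_density (t m) v y) \<partial>M)
        + ennreal (q y) * W \<partial>lborel) = 1 + (div_from 1 (mvn_density c v) q + W)"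
    using \<open>0 < v\<close> by (simp add: nn_integral_add nn_integral_cmult nn_integral_multc nn_integral_mixture[OF M] div_from_def one ac_simps)
  ultimately have "1 + mean_div 1 v M t q = 1 + (div_from 1 (mvn_density c v) q + W)"
    unfolding pt by simp
  then show ?thesis by (simp add: ennreal_add_left_cancel W_def)
qed

section \<open>Bayes predictive densities as minimizers\<close>

text \<open>Optimality and uniqueness follow from the Pythagorean identities by cancelling their finite terms.
  The moment condition provides finiteness for \<open>\<alpha> = - 1\<close>; for larger \<open>\<alpha>\<close> the loss is bounded.\<close>

lemma mean_div_minimizer:
  fixes t :: "'m \<Rightarrow> real ^ 'p"
  assumes \<alpha>: "- 1 \<le> \<alpha>" "\<alpha> < 1"
    and M: "prob_space M" and t[measurable]: "t \<in> borel_measurable M" and v: "0 < v" and C: "0 < C"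
    and r: "prob_density r" "\<And>y. 0 < r y"
    and E: "\<And>y. (\<integral>\<^sup>+ m. ennreal (mvn_density (t m) v y powr ((1 - \<alpha>) / 2)) \<partial>M) = ennreal (C * r y powr ((1 - \<alpha>) / 2))"
    and fin: "(\<integral>\<^sup>+ y. ennreal ((norm (y - a))\<^sup>2 * r y) \<partial>lborel) < \<infinity>"
  shows "mean_div \<alpha> v M t r < \<infinity>"
    and "prob_density q \<Longrightarrow> mean_div \<alpha> v M t r \<le> mean_div \<alpha> v M t q"
    and "prob_density q \<Longrightarrow> mean_div \<alpha> v M t q \<le> mean_div \<alpha> v M t r \<Longrightarrow> AE y in lborel. q y = r y"
proof -
  have rm[measurable]: "r \<in> borel_measurable borel" and r1: "(\<integral>\<^sup>+ y. ennreal (r y) \<partial>lborel) = 1"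
    using r(1) by (auto simp: prob_density_def)
  have "mean_div \<alpha> v M t r < \<infinity> \<and> (\<forall>q. prob_density q \<longrightarrow> mean_div \<alpha> v M t r \<le> mean_div \<alpha> v M t q
      \<and> (mean_div \<alpha> v M t q \<le> mean_div \<alpha> v M t r \<longrightarrow> div_from \<alpha> r q = 0))"
  proof (cases "\<alpha> = - 1")
    case True
    have E1: "(\<integral>\<^sup>+ m. ennreal (mvn_density (t m) v y) \<partial>M) = ennreal C * ennreal (r y)" for y
      using E[of y] True v r(2)[of y] C by (simp add: mvn_density_pos less_imp_le ennreal_mult)
    \<comment> \<open>Here \<open>s = 1\<close> and both the mixture and \<open>r\<close> have total mass \<open>1\<close>.\<close>
    have "(1 :: ennreal) = ennreal C"
      using nn_integral_mixture[OF M t v] by (simp add: E1 nn_integral_cmult r1)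
    then have E2: "(\<integral>\<^sup>+ m. ennreal (mvn_density (t m) v y) \<partial>M) = ennreal (r y)" for y
      using E1 by simp
    have f: "mean_div (- 1) v M t r < \<infinity>" by (rule mean_div_mixture_finite[OF M t v r E2 fin])
    have "mean_div (- 1) v M t q = mean_div (- 1) v M t r + div_from (- 1) r q" if "prob_density q" for q
      by (rule mean_div_mixture[OF M t v r E2 that])
    moreover have "x + y \<le> x \<Longrightarrow> y = 0" if "x < \<infinity>" for x y :: ennreal
      using ennreal_add_left_cancel_le[of x y 0] that by auto
    ultimately show ?thesis using f unfolding True by (auto)
  next
    case False
    define \<kappa> where "\<kappa> = ennreal (4 / (1 - \<alpha>\<^sup>2))"
    have id: "mean_div \<alpha> v M t q + \<kappa> * ennreal C = \<kappa> + ennreal C * div_from \<alpha> r q" if "prob_density q" for q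
      unfolding \<kappa>_def
      by (rule mean_div_power_mean) (use False \<alpha> M t v C r E that in auto)
    then have id': "\<kappa> * ennreal C + mean_div \<alpha> v M t q = \<kappa> + ennreal C * div_from \<alpha> r q" if "prob_density q" for q
      using that by (simp only: add.commute)
    have k: "\<kappa> < \<infinity>" "\<kappa> * ennreal C < \<infinity>" by (auto simp: \<kappa>_def ennreal_mult_less_top)
    have "div_from \<alpha> r r = 0" using \<alpha> r by (subst div_from_eq_0_iff) auto
    with id[OF r(1)] have rr: "\<kappa> * ennreal C + mean_div \<alpha> v M t r = \<kappa>" by (simp add: add.commute)
    then have "mean_div \<alpha> v M t r \<le> \<kappa>" by (metis le_iff_add add.commute)
    then have "mean_div \<alpha> v M t r < \<infinity>" using k by (auto intro: le_less_trans)
    moreover have "mean_div \<alpha> v M t r \<le> mean_div \<alpha> v M t q" if "prob_density q" for q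
    proof -
      have "\<kappa> * ennreal C + mean_div \<alpha> v M t r \<le> \<kappa> * ennreal C + mean_div \<alpha> v M t q"
        unfolding rr id'[OF that] by simp
      then show ?thesis using k by (auto simp: ennreal_add_left_cancel_le)
    qed
    moreover have "div_from \<alpha> r q = 0" if "prob_density q" "mean_div \<alpha> v M t q \<le> mean_div \<alpha> v M t r" for q
    proof -
      have "\<kappa> * ennreal C + mean_div \<alpha> v M t q \<le> \<kappa> * ennreal C + mean_div \<alpha> v M t r"
        using that by (intro add_left_mono)
      then have "\<kappa> + ennreal C * div_from \<alpha> r q \<le> \<kappa> + 0"
        unfolding rr id'[OF that(1)] by simp
      then have "ennreal C * div_from \<alpha> r q = 0"
        using k by (auto simp: ennreal_add_left_cancel_le)
      then show ?thesis using C by auto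
    qed
    ultimately show ?thesis by blast
  qed
  then show "mean_div \<alpha> v M t r < \<infinity>"
    and "prob_density q \<Longrightarrow> mean_div \<alpha> v M t r \<le> mean_div \<alpha> v M t q"
    and "prob_density q \<Longrightarrow> mean_div \<alpha> v M t q \<le> mean_div \<alpha> v M t r \<Longrightarrow> AE y in lborel. q y = r y"
    using div_from_eq_0_iff[of \<alpha> q r] \<alpha> r(2) rm by auto
qed

lemma posterior_risk_eq:
  assumes "- 1 \<le> \<alpha>" "\<alpha> \<le> 1" "0 < \<sigma>Y" "prob_density q"
  shows "posterior_risk \<alpha> \<sigma>1 \<sigma>2 \<sigma>Y \<pi> x q = enn2ereal (mean_div \<alpha> (\<sigma>Y\<^sup>2) (posterior \<sigma>1 \<sigma>2 \<pi> x) fst q)"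
  by (simp add: posterior_risk_def alpha_loss_eq assms ereal_integral_enn2ereal mean_div_def)

lemma bayes_predictive_iff:
  assumes "- 1 \<le> \<alpha>" "\<alpha> \<le> 1" "0 < \<sigma>Y"
  shows "bayes_predictive \<alpha> \<sigma>1 \<sigma>2 \<sigma>Y \<pi> x q \<longleftrightarrow>
    prob_density q \<and> mean_div \<alpha> (\<sigma>Y\<^sup>2) (posterior \<sigma>1 \<sigma>2 \<pi> x) fst q < \<infinity> \<and>
    (\<forall>q'. prob_density q' \<longrightarrow> mean_div \<alpha> (\<sigma>Y\<^sup>2) (posterior \<sigma>1 \<sigma>2 \<pi> x) fst q
       \<le> mean_div \<alpha> (\<sigma>Y\<^sup>2) (posterior \<sigma>1 \<sigma>2 \<pi> x) fst q')"
proof -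
  have "enn2ereal z < \<infinity> \<longleftrightarrow> z < \<infinity>" for z by (simp add: less_ennreal.rep_eq)
  then show ?thesis
    by (auto simp: bayes_predictive_def posterior_risk_eq assms less_eq_ennreal.rep_eq)
qed

lemma
  assumes \<pi>: "(\<lambda>\<theta>. \<theta>) \<in> borel_measurable \<pi>"
  shows fst_borel_measurable: "fst \<in> borel_measurable \<pi>"
    and likelihood_measurable: "likelihood \<sigma>1 \<sigma>2 x \<in> borel_measurable \<pi>"
proof -
  have [measurable]: "(\<lambda>\<theta>. fst \<theta>) \<in> borel_measurable \<pi>" "(\<lambda>\<theta>. snd \<theta>) \<in> borel_measurable \<pi>"
    by (auto intro!: measurable_compose[OF \<pi>] borel_measurable_continuous_onI continuous_intros)
  then show "fst \<in> borel_measurable \<pi>" by (simp add: eta_contract_eq)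
  show "likelihood \<sigma>1 \<sigma>2 x \<in> borel_measurable \<pi>"
    unfolding likelihood_def[abs_def] by measurable
qed

lemma nn_integral_posterior:
  assumes \<pi>: "(\<lambda>\<theta>. \<theta>) \<in> borel_measurable \<pi>" and [measurable]: "f \<in> borel_measurable \<pi>"
  shows "(\<integral>\<^sup>+ \<theta>. f \<theta> \<partial>posterior \<sigma>1 \<sigma>2 \<pi> x)
    = (\<integral>\<^sup>+ \<theta>. ennreal (likelihood \<sigma>1 \<sigma>2 x \<theta>) * f \<theta> \<partial>\<pi>) / marginal \<sigma>1 \<sigma>2 \<pi> x"
proof -
  note [measurable] = likelihood_measurable[OF \<pi>]
  have "(\<integral>\<^sup>+ \<theta>. f \<theta> \<partial>posterior \<sigma>1 \<sigma>2 \<pi> x)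
      = (\<integral>\<^sup>+ \<theta>. ennreal (likelihood \<sigma>1 \<sigma>2 x \<theta>) / marginal \<sigma>1 \<sigma>2 \<pi> x * f \<theta> \<partial>\<pi>)"
    unfolding posterior_def by (rule nn_integral_density) measurable
  also have "\<dots> = (\<integral>\<^sup>+ \<theta>. ennreal (likelihood \<sigma>1 \<sigma>2 x \<theta>) * f \<theta> / marginal \<sigma>1 \<sigma>2 \<pi> x \<partial>\<pi>)"
    by (simp add: divide_ennreal_def ac_simps)
  also have "\<dots> = (\<integral>\<^sup>+ \<theta>. ennreal (likelihood \<sigma>1 \<sigma>2 x \<theta>) * f \<theta> \<partial>\<pi>) / marginal \<sigma>1 \<sigma>2 \<pi> x"
    by (rule nn_integral_divide) measurable
  finally show ?thesis .
qed

lemma prob_space_posterior: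
  assumes \<pi>: "(\<lambda>\<theta>. \<theta>) \<in> borel_measurable \<pi>" and ex: "posterior_exists \<sigma>1 \<sigma>2 \<pi> x"
  shows "prob_space (posterior \<sigma>1 \<sigma>2 \<pi> x)"
proof
  have "emeasure (posterior \<sigma>1 \<sigma>2 \<pi> x) (space (posterior \<sigma>1 \<sigma>2 \<pi> x))
      = (\<integral>\<^sup>+ \<theta>. 1 \<partial>posterior \<sigma>1 \<sigma>2 \<pi> x)" by simp
  also have "\<dots> = marginal \<sigma>1 \<sigma>2 \<pi> x / marginal \<sigma>1 \<sigma>2 \<pi> x"
    using \<pi> by (subst nn_integral_posterior) (simp_all add: marginal_def)
  also have "\<dots> = 1" using ex by (intro ennreal_divide_self) (auto simp: posterior_exists_def)
  finally show "emeasure (posterior \<sigma>1 \<sigma>2 \<pi> x) (space (posterior \<sigma>1 \<sigma>2 \<pi> x)) = 1" .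
qed

lemma measurable_posterior [simp]: "borel_measurable (posterior \<sigma>1 \<sigma>2 \<pi> x) = borel_measurable \<pi>"
  by (intro measurable_cong_sets) (auto simp: posterior_def)

text \<open>Multiplying the likelihood by \<open>exp (z \<bullet> \<theta>\<^sub>1)\<close> amounts, up to a constant, to moving the observation \<open>x\<^sub>1\<close> by
  \<open>\<sigma>\<^sub>1\<^sup>2 z\<close>.  So existence of the posterior at all observations makes all exponential moments of \<open>\<theta>\<^sub>1\<close>
  finite at each of them.\<close>

lemma posterior_exp_moment:
  fixes x :: "(real ^ 'p) \<times> (real ^ 'p)"
  assumes "0 < \<sigma>1" and \<pi>: "(\<lambda>\<theta>. \<theta>) \<in> borel_measurable \<pi>" and ex: "\<And>x'. posterior_exists \<sigma>1 \<sigma>2 \<pi> x'"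
  shows "(\<integral>\<^sup>+ \<theta>. ennreal (exp (z \<bullet> fst \<theta>)) \<partial>posterior \<sigma>1 \<sigma>2 \<pi> x) < \<infinity>"
proof -
  note [measurable] = likelihood_measurable[OF \<pi>] fst_borel_measurable[OF \<pi>]
  define x' where "x' = (fst x + \<sigma>1\<^sup>2 *\<^sub>R z, snd x)"
  \<comment> \<open>The normalization of the exponential tilt, read off by completing the square.\<close>
  define k where "k = exp (z \<bullet> fst x + \<sigma>1\<^sup>2 * (z \<bullet> z) / 2)"
  have tilt: "likelihood \<sigma>1 \<sigma>2 x \<theta> * exp (z \<bullet> fst \<theta>) = k * likelihood \<sigma>1 \<sigma>2 x' \<theta>" for \<theta>
  proof -
    have sq: "(norm (fst x + \<sigma>1\<^sup>2 *\<^sub>R z - fst \<theta>))\<^sup>2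
        = (norm (fst x - fst \<theta>))\<^sup>2 + 2 * \<sigma>1\<^sup>2 * (z \<bullet> (fst x - fst \<theta>)) + (\<sigma>1\<^sup>2)\<^sup>2 * (z \<bullet> z)"
      unfolding power2_norm_eq_inner
      by (simp add: inner_add_left inner_add_right inner_diff_left inner_diff_right inner_commute
          power2_eq_square algebra_simps)
    have complete: "- A / (2 * w) + b = (a + w * d / 2) + - (A + 2 * w * (a - b) + w\<^sup>2 * d) / (2 * w)"
      if "0 < w" for A a b d w :: real
      using that by (simp add: divide_simps) (simp add: power2_eq_square algebra_simps)
    have "- (norm (fst x - fst \<theta>))\<^sup>2 / (2 * \<sigma>1\<^sup>2) + z \<bullet> fst \<theta>
        = (z \<bullet> fst x + \<sigma>1\<^sup>2 * (z \<bullet> z) / 2) + - (norm (fst x' - fst \<theta>))\<^sup>2 / (2 * \<sigma>1\<^sup>2)"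
      unfolding x'_def fst_conv sq inner_diff_right by (rule complete) (use assms(1) in simp)
    then have "exp (- (norm (fst x - fst \<theta>))\<^sup>2 / (2 * \<sigma>1\<^sup>2)) * exp (z \<bullet> fst \<theta>)
        = k * exp (- (norm (fst x' - fst \<theta>))\<^sup>2 / (2 * \<sigma>1\<^sup>2))"
      unfolding k_def exp_add[symmetric] by (rule arg_cong)
    moreover have "snd x' = snd x" by (simp add: x'_def)
    ultimately show ?thesis unfolding likelihood_def mvn_density_def by (simp add: ac_simps)
  qed
  have "(\<integral>\<^sup>+ \<theta>. ennreal (exp (z \<bullet> fst \<theta>)) \<partial>posterior \<sigma>1 \<sigma>2 \<pi> x)
      = (\<integral>\<^sup>+ \<theta>. ennreal (likelihood \<sigma>1 \<sigma>2 x \<theta>) * ennreal (exp (z \<bullet> fst \<theta>)) \<partial>\<pi>) / marginal \<sigma>1 \<sigma>2 \<pi> x"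
    using \<pi> by (intro nn_integral_posterior) auto
  also have "(\<integral>\<^sup>+ \<theta>. ennreal (likelihood \<sigma>1 \<sigma>2 x \<theta>) * ennreal (exp (z \<bullet> fst \<theta>)) \<partial>\<pi>)
      = (\<integral>\<^sup>+ \<theta>. ennreal k * ennreal (likelihood \<sigma>1 \<sigma>2 x' \<theta>) \<partial>\<pi>)"
    by (simp add: tilt k_def flip: ennreal_mult' ennreal_mult'')
  also have "\<dots> = ennreal k * marginal \<sigma>1 \<sigma>2 \<pi> x'"
    by (simp add: nn_integral_cmult marginal_def)
  finally show ?thesis
    using ex[of x] ex[of x']
    by (simp add: posterior_exists_def divide_ennreal_def ennreal_mult_less_top)
      (auto simp: top.not_eq_extremum[symmetric])
qed

text \<open>A square is dominated by exponentials, coordinate by coordinate.\<close>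

lemma posterior_second_moment:
  fixes x :: "(real ^ 'p) \<times> (real ^ 'p)" and c :: "real ^ 'p"
  assumes "0 < \<sigma>1" "0 < v" and \<pi>: "(\<lambda>\<theta>. \<theta>) \<in> borel_measurable \<pi>" and ex: "\<And>x'. posterior_exists \<sigma>1 \<sigma>2 \<pi> x'"
  shows "(\<integral>\<^sup>+ \<theta>. ennreal ((norm (fst \<theta> - c))\<^sup>2 / (2 * v)) \<partial>posterior \<sigma>1 \<sigma>2 \<pi> x) < \<infinity>"
proof -
  let ?P = "posterior \<sigma>1 \<sigma>2 \<pi> x"
  note [measurable] = fst_borel_measurable[OF \<pi>]
  interpret prob_space ?P using \<pi> ex by (rule prob_space_posterior)
  have pt: "ennreal ((norm (a - c))\<^sup>2 / (2 * v)) \<le> ennreal (2 / v) *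
      (ennreal ((norm c)\<^sup>2) + (\<Sum>b\<in>Basis. ennreal (exp (b \<bullet> a)) + ennreal (exp ((- b) \<bullet> a))))" for a :: "real ^ 'p"
  proof -
    have "s\<^sup>2 \<le> 2 * (exp s + exp (- s))" for s :: real
    proof -
      have "s\<^sup>2 \<le> 2 * exp s" if "0 \<le> s" for s :: real
        using exp_lower_Taylor_quadratic[OF that] that by simp
      from this[of s] this[of "- s"] show ?thesis
        by (cases "0 \<le> s") (auto simp: add_increasing add_increasing2)
    qed
    then have "(norm a)\<^sup>2 \<le> 2 * (\<Sum>b\<in>Basis. exp (b \<bullet> a) + exp ((- b) \<bullet> a))"
      unfolding sum_distrib_left power2_norm_eq_inner euclidean_inner[of a a]
      by (intro sum_mono) (simp add: power2_eq_square inner_commute)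
    moreover have "(norm (a - c))\<^sup>2 \<le> 2 * ((norm c)\<^sup>2 + (norm a)\<^sup>2)"
    proof -
      have "(norm (a - c))\<^sup>2 \<le> (norm a + norm c)\<^sup>2" by (intro power_mono norm_triangle_ineq4) auto
      also have "\<dots> \<le> 2 * ((norm c)\<^sup>2 + (norm a)\<^sup>2)"
        using sum_squares_ge_zero[of "norm a - norm c" 0] by (simp add: power2_eq_square algebra_simps)
      finally show ?thesis .
    qed
    moreover define S where "S = (\<Sum>b\<in>Basis. exp (b \<bullet> a) + exp ((- b) \<bullet> a))"
    ultimately have "(norm (a - c))\<^sup>2 \<le> 4 * ((norm c)\<^sup>2 + S)"
      using zero_le_power2[of "norm c"] unfolding S_def[symmetric] by argo
    then have "(norm (a - c))\<^sup>2 / (2 * v) \<le> 2 / v * ((norm c)\<^sup>2 + (\<Sum>b\<in>Basis. exp (b \<bullet> a) + exp ((- b) \<bullet> a)))"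
      unfolding S_def using assms(2) by (simp add: field_simps)
    then have "ennreal ((norm (a - c))\<^sup>2 / (2 * v)) \<le> ennreal (2 / v * ((norm c)\<^sup>2 + (\<Sum>b\<in>Basis. exp (b \<bullet> a) + exp ((- b) \<bullet> a))))"
      by (rule ennreal_leI)
    also have "\<dots> = ennreal (2 / v) *
      (ennreal ((norm c)\<^sup>2) + (\<Sum>b\<in>Basis. ennreal (exp (b \<bullet> a)) + ennreal (exp ((- b) \<bullet> a))))"
      using assms(2) by (subst ennreal_mult') (simp_all add: sum_nonneg sum_ennreal[symmetric] del: sum_ennreal)
    finally show ?thesis .
  qed
  have fin: "(\<integral>\<^sup>+ \<theta>. ennreal (exp (z \<bullet> fst \<theta>)) \<partial>?P) < \<infinity>" for z
    by (rule posterior_exp_moment[OF assms(1) \<pi> ex])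
  have "(\<integral>\<^sup>+ \<theta>. ennreal ((norm (fst \<theta> - c))\<^sup>2 / (2 * v)) \<partial>?P) \<le>
      (\<integral>\<^sup>+ \<theta>. ennreal (2 / v) * (ennreal ((norm c)\<^sup>2)
        + (\<Sum>b\<in>Basis. ennreal (exp (b \<bullet> fst \<theta>)) + ennreal (exp ((- b) \<bullet> fst \<theta>)))) \<partial>?P)"
    by (intro nn_integral_mono pt)
  also have "\<dots> = ennreal (2 / v) * (ennreal ((norm c)\<^sup>2)
        + (\<Sum>b\<in>Basis. (\<integral>\<^sup>+ \<theta>. ennreal (exp (b \<bullet> fst \<theta>)) \<partial>?P) + (\<integral>\<^sup>+ \<theta>. ennreal (exp ((- b) \<bullet> fst \<theta>)) \<partial>?P)))"
    by (simp add: nn_integral_cmult nn_integral_add nn_integral_sum emeasure_space_1)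
  also have "\<dots> < \<infinity>"
    using fin fin[of "- z" for z] by (simp add: ennreal_mult_less_top)
  finally show ?thesis .
qed

text \<open>A Bayes predictive density has finite risk by definition, so its existence forces the posterior
  variance of \<open>\<theta>\<^sub>1\<close> to be finite.  Conversely, a finite variance is, up to scale, the minimal risk, and it
  is attained at \<open>r\<close> only.\<close>

lemma bayes_predictive_reverse_kl:
  fixes x :: "(real ^ 'p) \<times> (real ^ 'p)"
  assumes \<sigma>: "0 < \<sigma>1" "0 < \<sigma>Y" and \<pi>: "(\<lambda>\<theta>. \<theta>) \<in> borel_measurable \<pi>"
    and ex: "posterior_exists \<sigma>1 \<sigma>2 \<pi> x" and int: "integrable (posterior \<sigma>1 \<sigma>2 \<pi> x) fst"
  defines "r \<equiv> mvn_density (\<integral>\<theta>. fst \<theta> \<partial>posterior \<sigma>1 \<sigma>2 \<pi> x) (\<sigma>Y\<^sup>2)"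
  shows "bayes_predictive 1 \<sigma>1 \<sigma>2 \<sigma>Y \<pi> x q \<Longrightarrow> AE y in lborel. q y = r y"
    and "(\<forall>x'. posterior_exists \<sigma>1 \<sigma>2 \<pi> x') \<or> (\<exists>q. prob_density q \<and> posterior_risk 1 \<sigma>1 \<sigma>2 \<sigma>Y \<pi> x q < \<infinity>)
      \<Longrightarrow> bayes_predictive 1 \<sigma>1 \<sigma>2 \<sigma>Y \<pi> x r"
proof -
  let ?P = "posterior \<sigma>1 \<sigma>2 \<pi> x"
  let ?c = "\<integral>\<theta>. fst \<theta> \<partial>?P"
  let ?R = "mean_div 1 (\<sigma>Y\<^sup>2) ?P fst"
  have P: "prob_space ?P" using \<pi> ex by (rule prob_space_posterior)
  define W where "W = (\<integral>\<^sup>+ \<theta>. ennreal ((norm (fst \<theta> - ?c))\<^sup>2 / (2 * \<sigma>Y\<^sup>2)) \<partial>?P)"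
  have v: "0 < \<sigma>Y\<^sup>2" using \<sigma> by simp
  have R: "?R q = div_from 1 r q + W" if "prob_density q" for q
    unfolding r_def W_def by (rule mean_div_reverse_kl[OF P int v that])
  have r: "prob_density r" "\<And>y. 0 < r y" "r \<in> borel_measurable borel"
    unfolding r_def using v by (auto simp: prob_density_mvn_density mvn_density_pos)
  have D: "div_from 1 r q = 0 \<longleftrightarrow> (AE y in lborel. q y = r y)" if "prob_density q" for q
    using that r by (intro div_from_eq_0_iff) auto
  have Rr: "?R r = W" using D[OF r(1)] R[OF r(1)] by simp
  note iff = bayes_predictive_iff[of 1 \<sigma>Y \<sigma>1 \<sigma>2 \<pi> x, OF _ _ \<sigma>(2), simplified]
  show "AE y in lborel. q y = r y" if b: "bayes_predictive 1 \<sigma>1 \<sigma>2 \<sigma>Y \<pi> x q"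
  proof -
    have q: "prob_density q" "?R q < \<infinity>" "?R q \<le> ?R r" using b r(1) unfolding iff by auto
    then have "W < \<infinity>" and "W + div_from 1 r q \<le> W + 0"
      unfolding R[OF q(1)] Rr by (auto simp: add.commute)
    then have "div_from 1 r q = 0" by (auto simp: ennreal_add_left_cancel_le)
    then show ?thesis using D q by simp
  qed
  assume "(\<forall>x'. posterior_exists \<sigma>1 \<sigma>2 \<pi> x') \<or> (\<exists>q. prob_density q \<and> posterior_risk 1 \<sigma>1 \<sigma>2 \<sigma>Y \<pi> x q < \<infinity>)"
  then have "W < \<infinity>"
  proof
    assume "\<forall>x'. posterior_exists \<sigma>1 \<sigma>2 \<pi> x'"
    then show ?thesis unfolding W_def using \<sigma> v \<pi> by (intro posterior_second_moment) auto
  next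
    assume "\<exists>q. prob_density q \<and> posterior_risk 1 \<sigma>1 \<sigma>2 \<sigma>Y \<pi> x q < \<infinity>"
    then obtain q where q: "prob_density q" "enn2ereal (?R q) < \<infinity>"
      using \<sigma> by (auto simp: posterior_risk_eq)
    then have "?R q < \<infinity>" by (simp add: less_ennreal.rep_eq)
    then show ?thesis unfolding R[OF q(1)] by simp
  qed
  then show "bayes_predictive 1 \<sigma>1 \<sigma>2 \<sigma>Y \<pi> x r"
    unfolding iff Rr using r(1) R by simp
qed

section \<open>The minimum risk equivariant density\<close>

text \<open>Shifting the integration variable by \<open>x\<^sub>1\<close> moves the data dependence of an equivariant rule into the
  location of the density to be predicted.\<close>

lemma frequentist_risk_eq:
  fixes q :: "real ^ 'p \<Rightarrow> real ^ 'p \<Rightarrow> real"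
  assumes "- 1 \<le> \<alpha>" "\<alpha> \<le> 1" "0 < \<sigma>Y" and q: "equivariant_predictive q"
  shows "frequentist_risk \<alpha> \<sigma>1 \<sigma>Y \<theta> q
    = enn2ereal (mean_div \<alpha> (\<sigma>Y\<^sup>2) (density lborel (\<lambda>x1. ennreal (mvn_density \<theta> (\<sigma>1\<^sup>2) x1))) (\<lambda>x1. \<theta> - x1) (q 0))"
proof -
  have pd: "\<And>x1. prob_density (q x1)" and eqv: "\<And>x1 y a. q (x1 + a) (y + a) = q x1 y"
    using q by (auto simp: equivariant_predictive_def)
  have "alpha_loss \<alpha> \<sigma>Y \<theta> (q x1)
      = enn2ereal (\<integral>\<^sup>+ y. pw_div \<alpha> (q 0 y) (mvn_density (\<theta> - x1) (\<sigma>Y\<^sup>2) y) \<partial>lborel)" for x1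
  proof -
    have [measurable]: "q x1 \<in> borel_measurable borel" using pd[of x1] by (simp add: prob_density_def)
    have "(\<integral>\<^sup>+ y. pw_div \<alpha> (q x1 y) (mvn_density \<theta> (\<sigma>Y\<^sup>2) y) \<partial>lborel)
        = (\<integral>\<^sup>+ y. pw_div \<alpha> (q x1 (y + x1)) (mvn_density \<theta> (\<sigma>Y\<^sup>2) (y + x1)) \<partial>lborel)"
      by (rule nn_integral_lborel_shift[symmetric]) measurable
    then show ?thesis
      using eqv[of 0 x1] by (simp add: alpha_loss_eq assms pd mvn_density_shift)
  qed
  then show ?thesis
    by (simp add: frequentist_risk_def ereal_integral_enn2ereal mean_div_def)
qed

text \<open>The locations \<open>\<theta> - x\<^sub>1\<close> are centred normal with variance \<open>\<sigma>\<^sub>1\<^sup>2\<close>.  Powers of \<open>q\<^sub>m\<close> have variance \<open>\<sigma>\<^sub>Y\<^sup>2 / s\<close>, their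
  average has variance \<open>\<sigma>\<^sub>1\<^sup>2 + \<sigma>\<^sub>Y\<^sup>2 / s\<close>, and taking the power \<open>1 / s\<close> leaves \<open>s \<sigma>\<^sub>1\<^sup>2 + \<sigma>\<^sub>Y\<^sup>2\<close>.\<close>

lemma min_risk_equivariant_mvn_density:
  fixes \<sigma>1 \<sigma>Y :: real
  assumes \<alpha>: "- 1 \<le> \<alpha>" "\<alpha> < 1" and \<sigma>: "0 < \<sigma>1" "0 < \<sigma>Y"
  defines "r \<equiv> (\<lambda>x1 :: real ^ 'p. mvn_density x1 (\<sigma>1\<^sup>2 * ((1 - \<alpha>) / 2) + \<sigma>Y\<^sup>2))"
  shows "min_risk_equivariant \<alpha> \<sigma>1 \<sigma>Y r"
    and "min_risk_equivariant \<alpha> \<sigma>1 \<sigma>Y q \<Longrightarrow> AE y in lborel. q x1 y = r x1 y"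
proof -
  define s where "s = (1 - \<alpha>) / 2"
  define w where "w = \<sigma>1\<^sup>2 * s + \<sigma>Y\<^sup>2"
  have s: "0 < s" using \<alpha> by (simp add: s_def)
  have v: "0 < \<sigma>Y\<^sup>2" "0 < \<sigma>1\<^sup>2" using \<sigma> by auto
  then have w: "0 < w" using s by (auto simp: w_def add_pos_pos)
  have r_w: "r x1 = mvn_density x1 w" for x1 by (simp add: r_def w_def s_def)
  have r: "equivariant_predictive r"
    unfolding equivariant_predictive_def r_w using w by (simp add: prob_density_mvn_density mvn_density_shift)
  obtain K where K: "0 < K" "\<And>(\<mu> :: real ^ 'p) y. mvn_density \<mu> (\<sigma>Y\<^sup>2) y powr s = K * mvn_density \<mu> (\<sigma>Y\<^sup>2 / s) y"
    using mvn_density_powr[OF v(1) s] by metis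
  obtain L where L: "0 < L" "\<And>(\<mu> :: real ^ 'p) y. mvn_density \<mu> w y powr s = L * mvn_density \<mu> (w / s) y"
    using mvn_density_powr[OF w s] by metis
  let ?M = "\<lambda>\<theta>. density lborel (\<lambda>x1. ennreal (mvn_density \<theta> (\<sigma>1\<^sup>2) x1))"
  have M: "prob_space (?M \<theta>)" for \<theta> :: "real ^ 'p"
    using nn_integral_mvn_density[OF v(2)] by (intro prob_spaceI) (simp add: emeasure_density)
  have ws: "\<sigma>1\<^sup>2 + \<sigma>Y\<^sup>2 / s = w / s" using s by (simp add: w_def field_simps)
  have E: "(\<integral>\<^sup>+ x1. ennreal (mvn_density (\<theta> - x1) (\<sigma>Y\<^sup>2) y powr ((1 - \<alpha>) / 2)) \<partial>?M \<theta>)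
      = ennreal (K / L * r 0 y powr ((1 - \<alpha>) / 2))" for \<theta> y :: "real ^ 'p"
  proof -
    have sh: "mvn_density (\<theta> - x1) u y = mvn_density (\<theta> - y) u x1" for u x1
      by (simp add: mvn_density_def algebra_simps)
    have "(\<integral>\<^sup>+ x1. ennreal (mvn_density (\<theta> - x1) (\<sigma>Y\<^sup>2) y powr s) \<partial>?M \<theta>)
       = (\<integral>\<^sup>+ x1. ennreal K * ennreal (mvn_density \<theta> (\<sigma>1\<^sup>2) x1 * mvn_density (\<theta> - y) (\<sigma>Y\<^sup>2 / s) x1) \<partial>lborel)"
      using v s K(1)
      by (simp add: nn_integral_density K(2) sh mvn_density_pos less_imp_le ac_simps flip: ennreal_mult)
    also have "\<dots> = ennreal K * ennreal (mvn_density \<theta> (w / s) (\<theta> - y))"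
      using v s by (simp add: nn_integral_cmult nn_integral_mvn_density_mult ws)
    also have "mvn_density \<theta> (w / s) (\<theta> - y) = mvn_density 0 (w / s) y"
      by (simp add: mvn_density_def)
    also have "ennreal K * ennreal \<dots> = ennreal (K / L * r 0 y powr s)"
      unfolding r_w L(2) using K(1) L(1) by (simp add: ennreal_mult')
    finally show ?thesis unfolding s_def .
  qed
  have r0: "prob_density (r 0)" "\<And>y. 0 < r 0 y"
    unfolding r_w using w by (auto simp: prob_density_mvn_density mvn_density_pos)
  have fin: "(\<integral>\<^sup>+ y. ennreal ((norm (y - 0))\<^sup>2 * r 0 y) \<partial>lborel) < \<infinity>"
    unfolding r_w by (rule nn_integral_mvn_density_second_moment[OF w])
  have KL: "0 < K / L" using K L by simp
  have meas: "(\<lambda>x1. \<theta> - x1) \<in> borel_measurable (?M \<theta>)" for \<theta> :: "real ^ 'p" by simp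
  note min = mean_div_minimizer[OF \<alpha> M meas v(1) KL r0 E fin]
  have pd: "prob_density (q 0)" if "equivariant_predictive q" for q :: "real ^ 'p \<Rightarrow> real ^ 'p \<Rightarrow> real"
    using that by (simp add: equivariant_predictive_def)
  have "\<alpha> \<le> 1" using \<alpha> by simp
  note risk = frequentist_risk_eq[OF \<alpha>(1) this \<sigma>(2)]
  show "min_risk_equivariant \<alpha> \<sigma>1 \<sigma>Y r"
    unfolding min_risk_equivariant_def using r min(2)[OF pd] by (simp add: risk less_eq_ennreal.rep_eq)
  assume q: "min_risk_equivariant \<alpha> \<sigma>1 \<sigma>Y q"
  then have eq: "equivariant_predictive q" by (simp add: min_risk_equivariant_def)
  have "frequentist_risk \<alpha> \<sigma>1 \<sigma>Y 0 q \<le> frequentist_risk \<alpha> \<sigma>1 \<sigma>Y 0 r"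
    using q r by (simp add: min_risk_equivariant_def)
  then have ae: "AE y in lborel. q 0 y = r 0 y"
    by (intro min(3)[OF pd[OF eq], of 0]) (simp add: risk eq r less_eq_ennreal.rep_eq)
  have [measurable]: "q 0 \<in> borel_measurable borel" "r 0 \<in> borel_measurable borel"
    using pd[OF eq] r0 by (auto simp: prob_density_def)
  have "AE y in distr lborel borel ((+) (- x1)). q 0 y = r 0 y"
    unfolding lborel_distr_plus by (rule ae)
  then have "AE y in lborel. q 0 (- x1 + y) = r 0 (- x1 + y)"
    by (subst (asm) AE_distr_iff) auto
  moreover have at_0: "f 0 (- x1 + y) = f x1 y"
    if "equivariant_predictive f" for f :: "real ^ 'p \<Rightarrow> real ^ 'p \<Rightarrow> real" and y
  proof -
    have "f (0 + x1) ((- x1 + y) + x1) = f 0 (- x1 + y)"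
      using that unfolding equivariant_predictive_def by blast
    then show ?thesis by simp
  qed
  ultimately show "AE y in lborel. q x1 y = r x1 y" by (simp only: at_0[OF eq] at_0[OF r])
qed

section \<open>The uniform prior on a set of differences\<close>

text \<open>By Tonelli and translation invariance, the preimage of a null set under subtraction is null.\<close>

lemma AE_lborel_diff:
  fixes N :: "(real ^ 'p) set"
  assumes "N \<in> null_sets lborel"
  shows "AE \<theta> in (lborel :: ((real ^ 'p) \<times> (real ^ 'p)) measure). fst \<theta> - snd \<theta> \<notin> N"
proof -
  have [measurable]: "N \<in> sets borel" and N: "emeasure lborel N = 0" using assms by auto
  have 1: "(\<lambda>\<theta>. indicator N (fst \<theta> - snd \<theta>) :: ennreal) \<in> borel_measurable (lborel \<Otimes>\<^sub>M lborel)"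
    by measurable
  have "(\<integral>\<^sup>+ \<theta>. indicator N (fst \<theta> - snd \<theta>) \<partial>(lborel \<Otimes>\<^sub>M lborel))
      = (\<integral>\<^sup>+ b. \<integral>\<^sup>+ a. indicator N (a + - b) \<partial>lborel \<partial>(lborel :: (real ^ 'p) measure))"
    using lborel_pair.nn_integral_snd[OF 1] by simp
  also have "\<dots> = 0"
    by (subst nn_integral_lborel_shift) (auto simp: N)
  finally have "AE \<theta> in lborel \<Otimes>\<^sub>M lborel. indicator N (fst \<theta> - snd \<theta>) = (0 :: ennreal)"
    using nn_integral_0_iff_AE[OF 1] by simp
  then show ?thesis unfolding lborel_prod by eventually_elim (auto simp: indicator_def split: if_splits)
qed

lemma indicator_diff_measurable:
  fixes B :: "(real ^ 'p) set"
  assumes [measurable]: "B \<in> sets borel"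
  shows "(\<lambda>\<theta>. indicator B (fst \<theta> - snd \<theta>) :: ennreal) \<in> borel_measurable lebesgue"
proof -
  have "(\<lambda>\<theta> :: (real ^ 'p) \<times> (real ^ 'p). indicator B (fst \<theta> - snd \<theta>) :: ennreal)
      \<in> borel_measurable (borel \<Otimes>\<^sub>M borel)" by measurable
  then show ?thesis unfolding borel_prod by (intro measurable_completion) simp
qed

text \<open>A Lebesgue set differs from a Borel set by a subset of a Borel null set.  Neither the prior nor
  \<open>I(y; x)\<close> sees the difference, so the remaining arguments may assume a Borel set.\<close>

lemma uniform_prior_borel:
  fixes A :: "(real ^ 'p) set"
  assumes "A \<in> sets lebesgue" "0 < emeasure lebesgue A"
  obtains B where "B \<in> sets borel" "0 < emeasure lborel B" "uniform_prior A = uniform_prior B"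
    "\<And>\<alpha> \<sigma>1 \<sigma>2 \<sigma>Y x y. I_factor \<alpha> \<sigma>1 \<sigma>2 \<sigma>Y A x y = I_factor \<alpha> \<sigma>1 \<sigma>2 \<sigma>Y B x y"
proof -
  obtain S N N' where A: "A = S \<union> N" "N \<subseteq> N'" and N': "N' \<in> null_sets lborel" and S: "S \<in> sets lborel"
    using assms(1) by (rule sets_completionE)
  have [measurable]: "S \<in> sets borel" "N' \<in> sets borel" using S N' by auto
  have SA: "AE u in lebesgue. u \<in> A \<longleftrightarrow> u \<in> S"
    using AE_completion[OF AE_not_in[OF N']] by eventually_elim (use A in auto)
  have "emeasure lebesgue A = emeasure lebesgue S"
    using SA assms S by (intro emeasure_eq_AE) auto
  then have pos: "0 < emeasure lborel S" using assms S by simp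
  have ae: "AE \<theta> in lebesgue. indicator A (fst \<theta> - snd \<theta>) = (indicator S (fst \<theta> - snd \<theta>) :: ennreal)"
    using AE_completion[OF AE_lborel_diff[OF N']] by eventually_elim (use A in \<open>auto simp: indicator_def\<close>)
  have preimage: "{\<theta> :: (real ^ 'p) \<times> (real ^ 'p). fst \<theta> - snd \<theta> \<in> D} \<in> sets borel"
    if "D \<in> sets borel" for D
  proof -
    have "(\<lambda>\<theta> :: (real ^ 'p) \<times> (real ^ 'p). fst \<theta> - snd \<theta>) \<in> borel_measurable borel"
      by (intro borel_measurable_continuous_onI continuous_intros)
    from measurable_sets[OF this that] show ?thesis by (simp add: vimage_def)
  qed
  have "{\<theta>. fst \<theta> - snd \<theta> \<in> N'} \<in> null_sets (lborel :: ((real ^ 'p) \<times> (real ^ 'p)) measure)"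
    using AE_lborel_diff[OF N'] preimage[of N'] by (subst (asm) AE_iff_null) auto
  moreover have "{\<theta> :: (real ^ 'p) \<times> (real ^ 'p). fst \<theta> - snd \<theta> \<in> S} \<in> sets lborel"
    using preimage[of S] by simp
  ultimately have "{\<theta> :: (real ^ 'p) \<times> (real ^ 'p). fst \<theta> - snd \<theta> \<in> A} \<in> sets lebesgue"
    by (intro sets_completionI[of _ "{\<theta>. fst \<theta> - snd \<theta> \<in> S}" "{\<theta>. fst \<theta> - snd \<theta> \<in> N}" "{\<theta>. fst \<theta> - snd \<theta> \<in> N'}"])
      (use A in auto)
  then have "(\<lambda>\<theta>. indicator {\<theta> :: (real ^ 'p) \<times> (real ^ 'p). fst \<theta> - snd \<theta> \<in> A} \<theta> :: ennreal) \<in> borel_measurable lebesgue"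
    by (rule borel_measurable_indicator)
  then have meas_A: "(\<lambda>\<theta> :: (real ^ 'p) \<times> (real ^ 'p). indicator A (fst \<theta> - snd \<theta>) :: ennreal) \<in> borel_measurable lebesgue"
    by (simp add: indicator_def)
  have prior: "uniform_prior A = uniform_prior S"
    unfolding uniform_prior_def using meas_A indicator_diff_measurable[OF \<open>S \<in> sets borel\<close>] ae by (rule density_cong)
  have fac: "emeasure (density lebesgue (\<lambda>t. ennreal (mvn_density \<mu> w t))) A
      = emeasure (density lebesgue (\<lambda>t. ennreal (mvn_density \<mu> w t))) S" for \<mu> :: "real ^ 'p" and w
  proof -
    have [measurable]: "(\<lambda>t. ennreal (mvn_density \<mu> w t)) \<in> borel_measurable lebesgue"
      by (intro measurable_completion) simp
    have "AE u in density lebesgue (\<lambda>t. ennreal (mvn_density \<mu> w t)). u \<in> A \<longleftrightarrow> u \<in> S"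
      by (subst AE_density) (use SA in auto)
    then show ?thesis using assms(1) S by (intro emeasure_eq_AE) auto
  qed
  have I: "I_factor \<alpha> \<sigma>1 \<sigma>2 \<sigma>Y A x y = I_factor \<alpha> \<sigma>1 \<sigma>2 \<sigma>Y S x y" for \<alpha> \<sigma>1 \<sigma>2 \<sigma>Y x y
    by (simp add: I_factor_def Let_def measure_def fac)
  show ?thesis by (rule that[OF \<open>S \<in> sets borel\<close> pos prior I])
qed

lemma nn_integral_uniform_prior:
  fixes B :: "(real ^ 'p) set" and F :: "(real ^ 'p) \<times> (real ^ 'p) \<Rightarrow> ennreal"
  assumes [measurable]: "B \<in> sets borel" "F \<in> borel_measurable borel"
  shows "(\<integral>\<^sup>+ \<theta>. F \<theta> \<partial>uniform_prior B)
    = (\<integral>\<^sup>+ b. \<integral>\<^sup>+ a. indicator B (a - b) * F (a, b) \<partial>lborel \<partial>lborel)"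
proof -
  have [measurable]: "F \<in> borel_measurable (lborel \<Otimes>\<^sub>M lborel)" by (simp add: lborel_prod)
  have 1: "(\<lambda>\<theta>. indicator B (fst \<theta> - snd \<theta>) * F \<theta>) \<in> borel_measurable (lborel \<Otimes>\<^sub>M lborel)"
    by measurable
  note m = indicator_diff_measurable[OF assms(1)]
  have "F \<in> borel_measurable lebesgue" by (intro measurable_completion) simp
  then have "(\<integral>\<^sup>+ \<theta>. F \<theta> \<partial>uniform_prior B) = (\<integral>\<^sup>+ \<theta>. indicator B (fst \<theta> - snd \<theta>) * F \<theta> \<partial>lebesgue)"
    unfolding uniform_prior_def by (rule nn_integral_density[OF m])
  also have "\<dots> = (\<integral>\<^sup>+ \<theta>. indicator B (fst \<theta> - snd \<theta>) * F \<theta> \<partial>(lborel \<Otimes>\<^sub>M lborel))"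
    by (simp add: nn_integral_completion lborel_prod)
  also have "\<dots> = (\<integral>\<^sup>+ b. \<integral>\<^sup>+ a. indicator B (a - b) * F (a, b) \<partial>lborel \<partial>lborel)"
    using lborel_pair.nn_integral_snd[OF 1] by simp
  finally show ?thesis .
qed

definition mvn_prob :: "(real ^ 'p) set \<Rightarrow> real ^ 'p \<Rightarrow> real \<Rightarrow> ennreal" where
  "mvn_prob B \<mu> v = (\<integral>\<^sup>+ u. indicator B u * ennreal (mvn_density \<mu> v u) \<partial>lborel)"

lemma mvn_prob_le_1: "0 < v \<Longrightarrow> mvn_prob B \<mu> v \<le> 1"
  unfolding mvn_prob_def nn_integral_mvn_density[of v \<mu>, symmetric]
  by (intro nn_integral_mono) (auto simp: indicator_def)

lemma mvn_prob_pos: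
  assumes [measurable]: "B \<in> sets borel" and "0 < emeasure lborel B" "0 < v"
  shows "0 < mvn_prob B \<mu> v"
proof (rule ccontr)
  assume "\<not> 0 < mvn_prob B \<mu> v"
  then have "AE u in lborel. indicator B u * ennreal (mvn_density \<mu> v u) = 0"
    unfolding mvn_prob_def by (subst nn_integral_0_iff_AE[symmetric]) auto
  moreover have "0 < mvn_density \<mu> v u" for u using assms(3) by (rule mvn_density_pos)
  ultimately have "AE u in lborel. u \<notin> B"
    by (auto elim!: eventually_mono simp: indicator_def ennreal_eq_0_iff not_le[symmetric] split: if_splits)
  then have "emeasure lborel B = 0" by (subst (asm) AE_iff_measurable[OF _ refl]) auto
  with assms(2) show False by simp
qed

lemma I_factor_eq_mvn_prob:
  assumes "B \<in> sets borel"
  shows "I_factor \<alpha> \<sigma>1 \<sigma>2 \<sigma>Y B x y = enn2real (mvn_prob B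
    (((1 - \<alpha>) * \<sigma>1\<^sup>2 / ((1 - \<alpha>) * \<sigma>1\<^sup>2 + 2 * \<sigma>Y\<^sup>2)) *\<^sub>R (y - fst x) + (fst x - snd x))
    (2 * \<sigma>1\<^sup>2 * \<sigma>Y\<^sup>2 / ((1 - \<alpha>) * \<sigma>1\<^sup>2 + 2 * \<sigma>Y\<^sup>2) + \<sigma>2\<^sup>2))"
proof -
  have "(\<lambda>t. ennreal (mvn_density \<mu> w t)) \<in> borel_measurable lebesgue" for \<mu> :: "real ^ 'a" and w
    by (intro measurable_completion) simp
  then show ?thesis
    using assms
    by (simp add: I_factor_def Let_def measure_def emeasure_density nn_integral_completion mvn_prob_def mult.commute)
qed

text \<open>The difference of two independent normal vectors is normal: substitute \<open>u = s - t\<close> and integrate the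
  product of two densities in \<open>t\<close> by completing the square.\<close>

lemma nn_integral_diff_mvn_density:
  fixes a b :: "real ^ 'p"
  assumes [measurable]: "B \<in> sets borel" and v: "0 < v" "0 < w"
  shows "(\<integral>\<^sup>+ t. \<integral>\<^sup>+ s. indicator B (s - t) * ennreal (mvn_density a v s * mvn_density b w t) \<partial>lborel \<partial>lborel)
    = mvn_prob B (a - b) (v + w)"
proof -
  have "(\<integral>\<^sup>+ t. \<integral>\<^sup>+ s. indicator B (s - t) * ennreal (mvn_density a v s * mvn_density b w t) \<partial>lborel \<partial>lborel)
      = (\<integral>\<^sup>+ t. \<integral>\<^sup>+ u. indicator B (u + t - t) * ennreal (mvn_density a v (u + t) * mvn_density b w t) \<partial>lborel \<partial>lborel)"
    by (intro nn_integral_cong nn_integral_lborel_shift[symmetric]) measurable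
  also have "\<dots> = (\<integral>\<^sup>+ u. \<integral>\<^sup>+ t. indicator B (u + t - t) * ennreal (mvn_density a v (u + t) * mvn_density b w t) \<partial>lborel \<partial>lborel)"
    by (rule lborel_pair.Fubini') measurable
  also have "\<dots> = (\<integral>\<^sup>+ u. indicator B u * (\<integral>\<^sup>+ t. ennreal (mvn_density (a - u) v t * mvn_density b w t) \<partial>lborel) \<partial>lborel)"
  proof (intro nn_integral_cong)
    fix u
    have "mvn_density a v (u + t) = mvn_density (a - u) v t" for t
      using mvn_density_shift[of a v t u] by (simp add: add.commute)
    then show "(\<integral>\<^sup>+ t. indicator B (u + t - t) * ennreal (mvn_density a v (u + t) * mvn_density b w t) \<partial>lborel)
        = indicator B u * (\<integral>\<^sup>+ t. ennreal (mvn_density (a - u) v t * mvn_density b w t) \<partial>lborel)"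
      by (simp add: nn_integral_cmult)
  qed
  also have "\<dots> = mvn_prob B (a - b) (v + w)"
  proof -
    have "mvn_density (a - u) (v + w) b = mvn_density (a - b) (v + w) u" for u
      by (simp add: mvn_density_def norm_minus_commute algebra_simps)
    then show ?thesis using v by (simp add: nn_integral_mvn_density_mult mvn_prob_def)
  qed
  finally show ?thesis .
qed

lemma id_measurable_uniform_prior: "(\<lambda>\<theta>. \<theta>) \<in> borel_measurable (uniform_prior B)"
proof -
  have "(\<lambda>\<theta>. \<theta>) \<in> borel_measurable lebesgue" by (intro measurable_completion) simp
  then show ?thesis unfolding uniform_prior_def by simp
qed

text \<open>Completing the square in \<open>\<theta>\<^sub>1\<close> turns the likelihood times \<open>q\<^sub>m(y)\<^sup>s\<close>, up to a constant, into a normal density in \<open>y\<close> with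
  variance \<open>\<sigma>\<^sub>1\<^sup>2 + \<sigma>\<^sub>Y\<^sup>2 / s\<close> times the densities of two independent normal vectors, whose difference has mean
  \<open>\<mu>\<^sub>T\<close> and variance \<open>\<sigma>\<^sub>T\<^sup>2\<close>.  The power \<open>1 / s\<close> of the result is a multiple of \<open>g\<close>.  Bounding \<open>I(y; x)\<close> by \<open>1\<close> shows
  that \<open>g\<close> is integrable and has a second moment.\<close>

lemma bayes_predictive_uniform_prior:
  fixes x :: "(real ^ 'p) \<times> (real ^ 'p)"
  assumes \<alpha>: "- 1 \<le> \<alpha>" "\<alpha> < 1" and \<sigma>: "0 < \<sigma>1" "0 < \<sigma>2" "0 < \<sigma>Y"
    and B[measurable]: "B \<in> sets borel" and pos: "0 < emeasure lborel B"
  defines "g \<equiv> (\<lambda>y. mvn_density (fst x) (\<sigma>1\<^sup>2 * ((1 - \<alpha>) / 2) + \<sigma>Y\<^sup>2) y *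
       I_factor \<alpha> \<sigma>1 \<sigma>2 \<sigma>Y B x y powr (2 / (1 - \<alpha>)))"
  obtains c where "0 < c" "bayes_predictive \<alpha> \<sigma>1 \<sigma>2 \<sigma>Y (uniform_prior B) x (\<lambda>y. c * g y)"
    "\<And>q. bayes_predictive \<alpha> \<sigma>1 \<sigma>2 \<sigma>Y (uniform_prior B) x q \<Longrightarrow> AE y in lborel. q y = c * g y"
proof -
  define s where "s = (1 - \<alpha>) / 2"
  define w where "w = \<sigma>1\<^sup>2 * s + \<sigma>Y\<^sup>2"
  define \<beta> where "\<beta> = (1 - \<alpha>) * \<sigma>1\<^sup>2 / ((1 - \<alpha>) * \<sigma>1\<^sup>2 + 2 * \<sigma>Y\<^sup>2)"
  define \<mu>T where "\<mu>T y = \<beta> *\<^sub>R (y - fst x) + (fst x - snd x)" for y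
  define vT where "vT = 2 * \<sigma>1\<^sup>2 * \<sigma>Y\<^sup>2 / ((1 - \<alpha>) * \<sigma>1\<^sup>2 + 2 * \<sigma>Y\<^sup>2) + \<sigma>2\<^sup>2"
  have s: "0 < s" "2 / (1 - \<alpha>) = 1 / s" "1 - \<alpha> = 2 * s" using \<alpha> by (auto simp: s_def)
  have v: "0 < \<sigma>1\<^sup>2" "0 < \<sigma>2\<^sup>2" "0 < \<sigma>Y\<^sup>2" using \<sigma> by auto
  have w: "0 < w" using v s by (auto simp: w_def intro!: add_pos_pos)
  have vY: "0 < \<sigma>Y\<^sup>2 / s" using v s by simp
  define V where "V = \<sigma>1\<^sup>2 * (\<sigma>Y\<^sup>2 / s) / (\<sigma>1\<^sup>2 + \<sigma>Y\<^sup>2 / s)"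
  have w2: "(1 - \<alpha>) * \<sigma>1\<^sup>2 + 2 * \<sigma>Y\<^sup>2 = 2 * w" by (simp add: w_def s_def field_simps)
  have ws: "\<sigma>1\<^sup>2 + \<sigma>Y\<^sup>2 / s = w / s" using s by (simp add: w_def field_simps)
  have V: "0 < V" "vT = V + \<sigma>2\<^sup>2"
    unfolding V_def vT_def ws w2 using v s w by (auto simp: field_simps)
  have vT: "0 < vT" unfolding V(2) using V(1) v(2) by (rule add_pos_pos)
  define I where "I y = enn2real (mvn_prob B (\<mu>T y) vT)" for y
  have I_prob: "ennreal (I y) = mvn_prob B (\<mu>T y) vT" for y
    unfolding I_def
    by (rule ennreal_enn2real) (rule le_less_trans[OF mvn_prob_le_1[OF vT] ennreal_one_less_top])
  have I01: "0 < I y" "I y \<le> 1" for y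
  proof -
    show "0 < I y" using mvn_prob_pos[OF B pos vT, of "\<mu>T y"] unfolding I_prob[symmetric] by simp
    show "I y \<le> 1" using mvn_prob_le_1[OF vT, of B "\<mu>T y"] unfolding I_prob[symmetric] by simp
  qed
  have Im[measurable]: "I \<in> borel_measurable borel"
    unfolding I_def[abs_def] mvn_prob_def \<mu>T_def by measurable
  define N where "N = mvn_density (fst x) w"
  have N: "0 < N y" for y using w by (simp add: N_def mvn_density_pos)
  have Nm[measurable]: "N \<in> borel_measurable borel" by (simp add: N_def)
  have g: "g y = N y * I y powr (1 / s)" for y
    unfolding g_def I_factor_eq_mvn_prob[OF B] I_def \<mu>T_def \<beta>_def vT_def N_def w_def s_def by simp
  have gm[measurable]: "g \<in> borel_measurable borel" unfolding g[abs_def] by measurable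
  have g_pos: "0 < g y" for y unfolding g using N[of y] I01(1)[of y] by simp
  have g_le: "g y \<le> N y" for y
    unfolding g using I01[of y] N[of y] s by (intro mult_left_le) (auto intro: powr_le1)
  define Z where "Z = (\<integral>\<^sup>+ y. ennreal (g y) \<partial>lborel)"
  have "Z \<le> (\<integral>\<^sup>+ y. ennreal (N y) \<partial>lborel)" unfolding Z_def using g_le by (intro nn_integral_mono ennreal_leI)
  also have "\<dots> = 1" unfolding N_def by (rule nn_integral_mvn_density[OF w])
  finally have "Z \<le> 1" .
  have "Z \<noteq> 0"
  proof
    assume "Z = 0"
    then have "AE y in (lborel :: (real ^ 'p) measure). False"
      unfolding Z_def by (subst (asm) nn_integral_0_iff_AE) (use g_pos in \<open>auto simp: ennreal_eq_0_iff not_le less_imp_neq\<close>)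
    then show False by (simp add: AE_iff_measurable[OF _ refl])
  qed
  with \<open>Z \<le> 1\<close> obtain z where z: "Z = ennreal z" "0 < z" by (cases Z) (auto simp: top_unique less_le)
  define c where "c = 1 / z"
  have c: "0 < c" using z by (simp add: c_def)
  define r where "r y = c * g y" for y
  have r_pos: "0 < r y" for y using c g_pos[of y] by (simp add: r_def)
  have r: "prob_density r"
  proof -
    have "(\<integral>\<^sup>+ y. ennreal (r y) \<partial>lborel) = ennreal c * Z"
      using c g_pos[THEN less_imp_le] by (simp add: r_def ennreal_mult nn_integral_cmult Z_def)
    also have "\<dots> = 1" using z c by (simp add: c_def flip: ennreal_mult)
    finally show ?thesis
      using r_pos[THEN less_imp_le] by (simp add: prob_density_def r_def[abs_def])
  qed

  let ?\<pi> = "uniform_prior B"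
  let ?P = "posterior \<sigma>1 \<sigma>2 ?\<pi> x"
  note \<pi> = id_measurable_uniform_prior[of B]
  have lik: "(\<lambda>\<theta>. likelihood \<sigma>1 \<sigma>2 x \<theta>) \<in> borel_measurable borel"
    using likelihood_measurable[of "borel :: ((real ^ 'p) \<times> (real ^ 'p)) measure"] by simp
  have fst_m: "(fst :: (real ^ 'p) \<times> (real ^ 'p) \<Rightarrow> _) \<in> borel_measurable borel"
    using fst_borel_measurable[of "borel :: ((real ^ 'p) \<times> (real ^ 'p)) measure"] by simp
  note [measurable] = lik fst_m
  have mg: "marginal \<sigma>1 \<sigma>2 ?\<pi> x = mvn_prob B (fst x - snd x) (\<sigma>1\<^sup>2 + \<sigma>2\<^sup>2)"
  proof -
    have "likelihood \<sigma>1 \<sigma>2 x (a, b) = mvn_density (fst x) (\<sigma>1\<^sup>2) a * mvn_density (snd x) (\<sigma>2\<^sup>2) b" for a b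
      by (simp add: likelihood_def mvn_density_sym[of a] mvn_density_sym[of b])
    moreover have "(\<lambda>\<theta>. ennreal (likelihood \<sigma>1 \<sigma>2 x \<theta>)) \<in> borel_measurable borel" by measurable
    ultimately show ?thesis
      unfolding marginal_def
      by (simp only: nn_integral_uniform_prior[OF B] nn_integral_diff_mvn_density[OF B v(1,2)])
  qed
  have v12: "0 < \<sigma>1\<^sup>2 + \<sigma>2\<^sup>2" using v(1,2) by (rule add_pos_pos)
  obtain m where m: "marginal \<sigma>1 \<sigma>2 ?\<pi> x = ennreal m" "0 < m"
    using mvn_prob_pos[OF B pos v12, of "fst x - snd x"] mvn_prob_le_1[OF v12, of B "fst x - snd x"]
    unfolding mg[symmetric] by (cases "marginal \<sigma>1 \<sigma>2 ?\<pi> x") (auto simp: top_unique)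
  have ex: "posterior_exists \<sigma>1 \<sigma>2 ?\<pi> x" using m by (simp add: posterior_exists_def)
  obtain K where K: "0 < K" "\<And>(\<mu> :: real ^ 'p) y. mvn_density \<mu> (\<sigma>Y\<^sup>2) y powr s = K * mvn_density \<mu> (\<sigma>Y\<^sup>2 / s) y"
    using mvn_density_powr[OF v(3) s(1)] by metis
  obtain L where L: "0 < L" "\<And>(\<mu> :: real ^ 'p) y. mvn_density \<mu> w y powr s = L * mvn_density \<mu> (w / s) y"
    using mvn_density_powr[OF w s(1)] by metis
  \<comment> \<open>The factors \<open>K\<close> and \<open>L\<close> come from the powers of the two normal densities, \<open>m\<close> and \<open>c\<close> from normalization.\<close>
  define C where "C = K / (m * L * c powr s)"
  have C: "0 < C" using K L m c by (simp add: C_def)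
  have E: "(\<integral>\<^sup>+ \<theta>. ennreal (mvn_density (fst \<theta>) (\<sigma>Y\<^sup>2) y powr ((1 - \<alpha>) / 2)) \<partial>?P)
      = ennreal (C * r y powr ((1 - \<alpha>) / 2))" for y
  proof -
    define k where "k = K * mvn_density (fst x) (w / s) y"
    have k: "0 \<le> k" using K w s by (simp add: k_def mvn_density_pos less_imp_le)
    define c1 where "c1 = ((\<sigma>Y\<^sup>2 / s) / (\<sigma>1\<^sup>2 + \<sigma>Y\<^sup>2 / s)) *\<^sub>R fst x + (\<sigma>1\<^sup>2 / (\<sigma>1\<^sup>2 + \<sigma>Y\<^sup>2 / s)) *\<^sub>R y"
    have c1: "c1 - snd x = \<mu>T y"
    proof -
      have "\<sigma>1\<^sup>2 / (\<sigma>1\<^sup>2 + \<sigma>Y\<^sup>2 / s) = \<beta>" "(\<sigma>Y\<^sup>2 / s) / (\<sigma>1\<^sup>2 + \<sigma>Y\<^sup>2 / s) = 1 - \<beta>"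
      proof -
        have \<beta>: "\<beta> = s * \<sigma>1\<^sup>2 / w" unfolding \<beta>_def w2 unfolding s(3) by simp
        show "\<sigma>1\<^sup>2 / (\<sigma>1\<^sup>2 + \<sigma>Y\<^sup>2 / s) = \<beta>" unfolding \<beta> ws using s(1) by (simp add: field_simps)
        have "1 - s * \<sigma>1\<^sup>2 / w = \<sigma>Y\<^sup>2 / w" using w by (simp add: diff_divide_eq_iff) (simp add: w_def)
        then show "(\<sigma>Y\<^sup>2 / s) / (\<sigma>1\<^sup>2 + \<sigma>Y\<^sup>2 / s) = 1 - \<beta>" unfolding \<beta> ws using s(1) by simp
      qed
      then have "c1 = (1 - \<beta>) *\<^sub>R fst x + \<beta> *\<^sub>R y" by (simp only: c1_def)
      then show ?thesis by (simp add: \<mu>T_def algebra_simps)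
    qed
    have split: "likelihood \<sigma>1 \<sigma>2 x (a, b) * mvn_density a (\<sigma>Y\<^sup>2) y powr s
        = k * (mvn_density c1 V a * mvn_density (snd x) (\<sigma>2\<^sup>2) b)" for a b
    proof -
      have "likelihood \<sigma>1 \<sigma>2 x (a, b) * mvn_density a (\<sigma>Y\<^sup>2) y powr s
        = K * (mvn_density (fst x) (\<sigma>1\<^sup>2) a * mvn_density y (\<sigma>Y\<^sup>2 / s) a) * mvn_density (snd x) (\<sigma>2\<^sup>2) b"
        unfolding K(2)
        by (simp add: likelihood_def mvn_density_sym[of a] mvn_density_sym[of b] ac_simps)
      also have "mvn_density (fst x) (\<sigma>1\<^sup>2) a * mvn_density y (\<sigma>Y\<^sup>2 / s) a
          = mvn_density (fst x) (w / s) y * mvn_density c1 V a"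
        unfolding mvn_density_mult[OF v(1) vY] ws[symmetric] c1_def V_def ..
      finally show ?thesis by (simp add: k_def ac_simps)
    qed
    have nn: "0 \<le> likelihood \<sigma>1 \<sigma>2 x \<theta>" for \<theta>
      using v by (simp add: likelihood_def mvn_density_pos less_imp_le)
    have m2: "(\<lambda>\<theta>. ennreal (mvn_density (fst \<theta>) (\<sigma>Y\<^sup>2) y powr s)) \<in> borel_measurable ?\<pi>"
    proof -
      note [measurable] = fst_borel_measurable[OF \<pi>]
      show ?thesis by measurable
    qed
    have "(\<integral>\<^sup>+ \<theta>. ennreal (mvn_density (fst \<theta>) (\<sigma>Y\<^sup>2) y powr s) \<partial>?P)
        = (\<integral>\<^sup>+ \<theta>. ennreal (likelihood \<sigma>1 \<sigma>2 x \<theta>) * ennreal (mvn_density (fst \<theta>) (\<sigma>Y\<^sup>2) y powr s) \<partial>?\<pi>) / ennreal m"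
      unfolding m(1)[symmetric] by (rule nn_integral_posterior[OF \<pi> m2])
    also have "(\<integral>\<^sup>+ \<theta>. ennreal (likelihood \<sigma>1 \<sigma>2 x \<theta>) * ennreal (mvn_density (fst \<theta>) (\<sigma>Y\<^sup>2) y powr s) \<partial>?\<pi>)
        = (\<integral>\<^sup>+ b. \<integral>\<^sup>+ a. indicator B (a - b) * (ennreal (likelihood \<sigma>1 \<sigma>2 x (a, b)) * ennreal (mvn_density a (\<sigma>Y\<^sup>2) y powr s)) \<partial>lborel \<partial>lborel)"
      by (subst nn_integral_uniform_prior) simp_all
    also have "\<dots> = (\<integral>\<^sup>+ b. \<integral>\<^sup>+ a. ennreal k * (indicator B (a - b) * ennreal (mvn_density c1 V a * mvn_density (snd x) (\<sigma>2\<^sup>2) b)) \<partial>lborel \<partial>lborel)"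
      using k nn by (simp add: split ennreal_mult'[of k] ac_simps flip: ennreal_mult)
    also have "\<dots> = ennreal k * (\<integral>\<^sup>+ b. \<integral>\<^sup>+ a. indicator B (a - b) * ennreal (mvn_density c1 V a * mvn_density (snd x) (\<sigma>2\<^sup>2) b) \<partial>lborel \<partial>lborel)"
      by (simp add: nn_integral_cmult)
    also have "\<dots> = ennreal k * ennreal (I y)"
      unfolding nn_integral_diff_mvn_density[OF B V(1) v(2)] c1 V(2)[symmetric] I_prob ..
    also have "\<dots> / ennreal m = ennreal (k * I y / m)"
      using k m I01(1)[of y] by (simp add: divide_ennreal flip: ennreal_mult)
    also have "k * I y / m = C * r y powr s"
    proof -
      have "r y powr s = c powr s * (N y powr s * I y)"
        unfolding r_def g using c N[of y] I01(1)[of y] s by (simp add: powr_mult powr_powr)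
      also have "N y powr s = L * mvn_density (fst x) (w / s) y" unfolding N_def L(2) ..
      finally show ?thesis using m L c by (simp add: C_def k_def)
    qed
    finally show ?thesis unfolding s_def .
  qed
  have fin: "(\<integral>\<^sup>+ y. ennreal ((norm (y - fst x))\<^sup>2 * r y) \<partial>lborel) < \<infinity>"
  proof -
    have "(\<integral>\<^sup>+ y. ennreal ((norm (y - fst x))\<^sup>2 * r y) \<partial>lborel)
        \<le> (\<integral>\<^sup>+ y. ennreal c * ennreal ((norm (y - fst x))\<^sup>2 * N y) \<partial>lborel)"
    proof (intro nn_integral_mono)
      fix y
      have "(norm (y - fst x))\<^sup>2 * r y \<le> c * ((norm (y - fst x))\<^sup>2 * N y)"
        using mult_left_mono[OF g_le[of y], of "c * (norm (y - fst x))\<^sup>2"] c by (simp add: r_def ac_simps)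
      then show "ennreal ((norm (y - fst x))\<^sup>2 * r y) \<le> ennreal c * ennreal ((norm (y - fst x))\<^sup>2 * N y)"
        using c by (simp add: ennreal_leI flip: ennreal_mult')
    qed
    also have "\<dots> < \<infinity>"
      using nn_integral_mvn_density_second_moment[OF w, of "fst x"]
      by (simp add: nn_integral_cmult ennreal_mult_less_top flip: N_def)
    finally show ?thesis .
  qed
  have t: "fst \<in> borel_measurable ?P" using fst_borel_measurable[OF \<pi>] by simp
  note min = mean_div_minimizer[OF \<alpha> prob_space_posterior[OF \<pi> ex] t v(3) C r r_pos E fin]
  have "\<alpha> \<le> 1" using \<alpha> by simp
  note iff = bayes_predictive_iff[OF \<alpha>(1) this \<sigma>(3), of \<sigma>1 \<sigma>2 ?\<pi> x]
  have "bayes_predictive \<alpha> \<sigma>1 \<sigma>2 \<sigma>Y ?\<pi> x r"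
    unfolding iff using r min(1,2) by blast
  moreover have "AE y in lborel. q y = r y" if "bayes_predictive \<alpha> \<sigma>1 \<sigma>2 \<sigma>Y ?\<pi> x q" for q
    using that r unfolding iff by (intro min(3)) auto
  ultimately show ?thesis using that[OF c] unfolding r_def[abs_def] by blast
qed

section \<open>The predictive densities of the theorem\<close>

theorem lemma2p1:
  fixes \<sigma>1 \<sigma>2 \<sigma>Y :: real and x :: "(real ^ 'p) \<times> (real ^ 'p)"
  assumes "0 < \<sigma>1" "0 < \<sigma>2" "0 < \<sigma>Y"
  shows
    "(\<forall>\<alpha> A. - 1 \<le> \<alpha> \<and> \<alpha> < 1 \<and> A \<in> sets lebesgue \<and> 0 < emeasure lebesgue A \<longrightarrow>
        (let q_mre = (\<lambda>x1 :: real ^ 'p. mvn_density x1 (\<sigma>1\<^sup>2 * ((1 - \<alpha>) / 2) + \<sigma>Y\<^sup>2)) in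
           min_risk_equivariant \<alpha> \<sigma>1 \<sigma>Y q_mre \<and>
           (\<forall>q. min_risk_equivariant \<alpha> \<sigma>1 \<sigma>Y q \<longrightarrow>
              (\<forall>x1. AE y in lborel. q x1 y = q_mre x1 y)) \<and>
           (\<exists>c > 0. let q_U = (\<lambda>y. c * (q_mre (fst x) y *
                          I_factor \<alpha> \<sigma>1 \<sigma>2 \<sigma>Y A x y powr (2 / (1 - \<alpha>)))) in
              bayes_predictive \<alpha> \<sigma>1 \<sigma>2 \<sigma>Y (uniform_prior A) x q_U \<and>
              (\<forall>q. bayes_predictive \<alpha> \<sigma>1 \<sigma>2 \<sigma>Y (uniform_prior A) x q \<longrightarrow>
                 (AE y in lborel. q y = q_U y))))) \<and>
     (\<forall>\<pi>. (\<lambda>\<theta>. \<theta>) \<in> borel_measurable \<pi> \<and> posterior_exists \<sigma>1 \<sigma>2 \<pi> x \<and>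
          integrable (posterior \<sigma>1 \<sigma>2 \<pi> x) fst \<longrightarrow>
        (let q_N = mvn_density (\<integral>\<theta>. fst \<theta> \<partial>posterior \<sigma>1 \<sigma>2 \<pi> x) (\<sigma>Y\<^sup>2) in
           (\<forall>q. bayes_predictive 1 \<sigma>1 \<sigma>2 \<sigma>Y \<pi> x q \<longrightarrow> (AE y in lborel. q y = q_N y)) \<and>
           ((\<forall>x'. posterior_exists \<sigma>1 \<sigma>2 \<pi> x') \<or>
            (\<exists>q. prob_density q \<and> posterior_risk 1 \<sigma>1 \<sigma>2 \<sigma>Y \<pi> x q < \<infinity>) \<longrightarrow>
              bayes_predictive 1 \<sigma>1 \<sigma>2 \<sigma>Y \<pi> x q_N)))"
proof (intro conjI allI impI)
  fix \<alpha> :: real and A :: "(real ^ 'p) set"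
  assume "- 1 \<le> \<alpha> \<and> \<alpha> < 1 \<and> A \<in> sets lebesgue \<and> 0 < emeasure lebesgue A"
  then have \<alpha>: "- 1 \<le> \<alpha>" "\<alpha> < 1" and A: "A \<in> sets lebesgue" "0 < emeasure lebesgue A" by auto
  obtain B where B: "B \<in> sets borel" "0 < emeasure lborel B" "uniform_prior A = uniform_prior B"
    "\<And>\<alpha> \<sigma>1 \<sigma>2 \<sigma>Y x y. I_factor \<alpha> \<sigma>1 \<sigma>2 \<sigma>Y A x y = I_factor \<alpha> \<sigma>1 \<sigma>2 \<sigma>Y B x y"
    by (rule uniform_prior_borel[OF A]) (rule that)
  obtain c where "0 < c"
    "bayes_predictive \<alpha> \<sigma>1 \<sigma>2 \<sigma>Y (uniform_prior B) x (\<lambda>y. c * (mvn_density (fst x) (\<sigma>1\<^sup>2 * ((1 - \<alpha>) / 2) + \<sigma>Y\<^sup>2) y *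
       I_factor \<alpha> \<sigma>1 \<sigma>2 \<sigma>Y B x y powr (2 / (1 - \<alpha>))))"
    "\<And>q. bayes_predictive \<alpha> \<sigma>1 \<sigma>2 \<sigma>Y (uniform_prior B) x q \<Longrightarrow>
       AE y in lborel. q y = c * (mvn_density (fst x) (\<sigma>1\<^sup>2 * ((1 - \<alpha>) / 2) + \<sigma>Y\<^sup>2) y *
       I_factor \<alpha> \<sigma>1 \<sigma>2 \<sigma>Y B x y powr (2 / (1 - \<alpha>)))"
    by (rule bayes_predictive_uniform_prior[OF \<alpha> assms B(1,2), of x]) (rule that)
  then show "let q_mre = (\<lambda>x1 :: real ^ 'p. mvn_density x1 (\<sigma>1\<^sup>2 * ((1 - \<alpha>) / 2) + \<sigma>Y\<^sup>2)) in
           min_risk_equivariant \<alpha> \<sigma>1 \<sigma>Y q_mre \<and>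
           (\<forall>q. min_risk_equivariant \<alpha> \<sigma>1 \<sigma>Y q \<longrightarrow>
              (\<forall>x1. AE y in lborel. q x1 y = q_mre x1 y)) \<and>
           (\<exists>c > 0. let q_U = (\<lambda>y. c * (q_mre (fst x) y *
                          I_factor \<alpha> \<sigma>1 \<sigma>2 \<sigma>Y A x y powr (2 / (1 - \<alpha>)))) in
              bayes_predictive \<alpha> \<sigma>1 \<sigma>2 \<sigma>Y (uniform_prior A) x q_U \<and>
              (\<forall>q. bayes_predictive \<alpha> \<sigma>1 \<sigma>2 \<sigma>Y (uniform_prior A) x q \<longrightarrow>
                 (AE y in lborel. q y = q_U y)))"
    unfolding Let_def B(3,4)
    using min_risk_equivariant_mvn_density[OF \<alpha> assms(1,3)] by blast
next
  fix \<pi> :: "((real ^ 'p) \<times> (real ^ 'p)) measure"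
  assume "(\<lambda>\<theta>. \<theta>) \<in> borel_measurable \<pi> \<and> posterior_exists \<sigma>1 \<sigma>2 \<pi> x \<and>
          integrable (posterior \<sigma>1 \<sigma>2 \<pi> x) fst"
  then show "let q_N = mvn_density (\<integral>\<theta>. fst \<theta> \<partial>posterior \<sigma>1 \<sigma>2 \<pi> x) (\<sigma>Y\<^sup>2) in
           (\<forall>q. bayes_predictive 1 \<sigma>1 \<sigma>2 \<sigma>Y \<pi> x q \<longrightarrow> (AE y in lborel. q y = q_N y)) \<and>
           ((\<forall>x'. posterior_exists \<sigma>1 \<sigma>2 \<pi> x') \<or>
            (\<exists>q. prob_density q \<and> posterior_risk 1 \<sigma>1 \<sigma>2 \<sigma>Y \<pi> x q < \<infinity>) \<longrightarrow>
              bayes_predictive 1 \<sigma>1 \<sigma>2 \<sigma>Y \<pi> x q_N)"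
    unfolding Let_def using bayes_predictive_reverse_kl[OF assms(1,3)] by blast
qed

end
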